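(* Let $f\in W^{-1,p'}(\Omega)\setminus\{0\}$ and $f\ge0$ in the weak sense. Assume that $\alpha>\lambda_1(p)$, $\beta\in\mathbb{R}$, and let $u$ be a (weak) solution of $$-\Delta_p u-\Delta_q u=\alpha|u|^{p-2}u+\beta|u|^{q-2}u+f(x)\ \text{ in }\Omega,\qquad u=0\ \text{ on }\partial\Omega.$$ Then the following assertions are satisfied: (i) if $\beta<\beta_f(\alpha)$ and $u^-\not\equiv0$, then $H_\alpha(u^-)<0$; (ii) if $\beta>\beta^f(\alpha)$ and $u^+\not\equiv0$, then $H_\alpha(u^+)>0$.
   Context: Standing assumptions: $N\ge 1$, $\Omega\subset\mathbb{R}^N$ is a bounded domain with $C^2$-boundary, $1<q<p<\infty$, $p'=p/(p-1)$; $\Delta_r u=\mathrm{div}(|\nabla u|^{r-2}\nabla u)$. $W_0^{1,p}=W_0^{1,p}(\Omega)$ has the norm $\|\nabla u\|_p$, where $\|\cdot\|_p$ is the $L^p(\Omega)$-norm; $W^{-1,p'}(\Omega)$ is its dual and $\langle f,u\rangle$ (written formally as $\int_\Omega fu\,dx$) is the dual pairing. "$f\ge0$ in the weak sense" means $\langle f,u\rangle\ge0$ for all $u\in W_0^{1,p}$ with $u\ge0$ a.e. A (weak) solution of the problem is a function $u\in W_0^{1,p}$ such that $\int_\Omega(|\nabla u|^{p-2}+|\nabla u|^{q-2})\nabla u\cdot\nabla\varphi\,dx=\int_\Omega(\alpha|u|^{p-2}u+\beta|u|^{q-2}u)\varphi\,dx+\langle f,\varphi\rangle$ for all $\varphi\in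 W_0^{1,p}$. $u^+:=\max\{u,0\}$, $u^-:=\min\{u,0\}$, so $u=u^++u^-$. $\lambda_1(p):=\inf\{\|\nabla u\|_p^p/\|u\|_p^p:\ u\in W_0^{1,p}\setminus\{0\}\}$. $H_\alpha(u):=\|\nabla u\|_p^p-\alpha\|u\|_p^p$. $\beta_f(\alpha):=\inf\{\Phi_\alpha^+(u):\ u\in\mathcal{B}^+(\alpha)\}$ for $\alpha\in\mathbb{R}$, and $\beta^f(\alpha):=\sup\{\Phi_\alpha^-(u):\ u\in\mathcal{B}^-(\alpha)\}$ for $\alpha\ge\lambda_1(p)$, where $$\Phi_\alpha^\pm(u):=\frac{\|\nabla u\|_q^q}{\|u\|_q^q}\pm\frac{p-1}{p-q}\left(\frac{p-q}{q-1}\right)^{\frac{q-1}{p-1}}\frac{(\pm H_\alpha(u))^{\frac{q-1}{p-1}}\langle f,u\rangle^{\frac{p-q}{p-1}}}{\|u\|_q^q},$$ $$\mathcal{B}^\pm(\alpha):=\{u\in W_0^{1,p}\setminus\{0\}:\ u\ge0\text{ a.e. in }\Omega\text{ and }\pm H_\alpha(u)\ge0\}$$ (upper signs together, lower signs together). *)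

theory Defs
  imports "HOL-Analysis.Analysis"
begin

section \<open>Smooth functions and domains\<close>

primrec Ck :: "nat \<Rightarrow> ('a::euclidean_space \<Rightarrow> real) \<Rightarrow> bool" where
  "Ck 0 \<phi> \<longleftrightarrow> continuous_on UNIV \<phi>"
| "Ck (Suc k) \<phi> \<longleftrightarrow> (\<forall>x. \<phi> differentiable (at x)) \<and>
     (\<forall>b\<in>Basis. Ck k (\<lambda>x. frechet_derivative \<phi> (at x) b))"

definition grad :: "('a::euclidean_space \<Rightarrow> real) \<Rightarrow> 'a \<Rightarrow> 'a" where
  "grad \<phi> x = (\<Sum>b\<in>Basis. frechet_derivative \<phi> (at x) b *\<^sub>R b)"

definition test_functions :: "'a::euclidean_space set \<Rightarrow> ('a \<Rightarrow> real) set" where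
  "test_functions \<Omega> = {\<phi>. (\<forall>k. Ck k \<phi>) \<and>
     compact (closure {x. \<phi> x \<noteq> 0}) \<and> closure {x. \<phi> x \<noteq> 0} \<subseteq> \<Omega>}"

text \<open>
  Near each boundary point the set lies strictly on one side of the graph of a \<open>C\<^sup>2\<close> function over
  the hyperplane orthogonal to some unit vector \<open>\<nu>\<close>; \<open>\<gamma>\<close> is evaluated only on that hyperplane.
  In dimension one the hyperplane is \<open>{0}\<close>, so this says that the set is locally a half-line.
\<close>
definition C2_boundary :: "'a::euclidean_space set \<Rightarrow> bool" where
  "C2_boundary \<Omega> \<longleftrightarrow> (\<forall>x\<^sub>0\<in>frontier \<Omega>. \<exists>r>0. \<exists>\<nu> \<gamma>. norm \<nu> = 1 \<and> Ck 2 \<gamma> \<and>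
     (\<forall>y\<in>ball x\<^sub>0 r. y \<in> \<Omega> \<longleftrightarrow> y \<bullet> \<nu> > \<gamma> (y - (y \<bullet> \<nu>) *\<^sub>R \<nu>)))"

section \<open>Lebesgue and Sobolev spaces\<close>

text \<open>
  Elements of the function spaces are represented by functions on the whole space; only their
  values almost everywhere in \<open>\<Omega>\<close> matter. Thus ``\<open>u \<noteq> 0\<close>'' is rendered by \<open>\<not> ae_zero \<Omega> u\<close>.
\<close>

definition ae_zero :: "'a::euclidean_space set \<Rightarrow> ('a \<Rightarrow> real) \<Rightarrow> bool" where
  "ae_zero \<Omega> u \<longleftrightarrow> (AE x in lebesgue_on \<Omega>. u x = 0)"

definition ae_nonneg :: "'a::euclidean_space set \<Rightarrow> ('a \<Rightarrow> real) \<Rightarrow> bool" where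
  "ae_nonneg \<Omega> u \<longleftrightarrow> (AE x in lebesgue_on \<Omega>. u x \<ge> 0)"

definition Lp_space :: "real \<Rightarrow> 'a::euclidean_space set \<Rightarrow> ('a \<Rightarrow> 'b::euclidean_space) set" where
  "Lp_space p \<Omega> = {u. u \<in> borel_measurable (lebesgue_on \<Omega>) \<and>
     integrable (lebesgue_on \<Omega>) (\<lambda>x. norm (u x) powr p)}"

definition Lp_norm :: "real \<Rightarrow> 'a::euclidean_space set \<Rightarrow> ('a \<Rightarrow> 'b::euclidean_space) \<Rightarrow> real" where
  "Lp_norm p \<Omega> u = (LINT x|lebesgue_on \<Omega>. norm (u x) powr p) powr (1 / p)"

definition locally_integrable ::
    "'a::euclidean_space set \<Rightarrow> ('a \<Rightarrow> 'b::euclidean_space) \<Rightarrow> bool" where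
  "locally_integrable \<Omega> u \<longleftrightarrow> (\<forall>K. compact K \<and> K \<subseteq> \<Omega> \<longrightarrow> integrable (lebesgue_on K) u)"

definition is_weak_gradient ::
    "'a::euclidean_space set \<Rightarrow> ('a \<Rightarrow> real) \<Rightarrow> ('a \<Rightarrow> 'a) \<Rightarrow> bool" where
  "is_weak_gradient \<Omega> u g \<longleftrightarrow> locally_integrable \<Omega> u \<and> locally_integrable \<Omega> g \<and>
     (\<forall>\<phi>\<in>test_functions \<Omega>. \<forall>b\<in>Basis.
        (LINT x|lebesgue_on \<Omega>. u x * (grad \<phi> x \<bullet> b)) =
        - (LINT x|lebesgue_on \<Omega>. (g x \<bullet> b) * \<phi> x))"

text \<open>For open \<open>\<Omega>\<close> a weak gradient is unique up to a null set, so the choice is immaterial.\<close>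
definition wgrad :: "'a::euclidean_space set \<Rightarrow> ('a \<Rightarrow> real) \<Rightarrow> 'a \<Rightarrow> 'a" where
  "wgrad \<Omega> u = (SOME g. is_weak_gradient \<Omega> u g)"

definition W1p :: "real \<Rightarrow> 'a::euclidean_space set \<Rightarrow> ('a \<Rightarrow> real) set" where
  "W1p p \<Omega> = {u. u \<in> Lp_space p \<Omega> \<and> (\<exists>g. is_weak_gradient \<Omega> u g) \<and> wgrad \<Omega> u \<in> Lp_space p \<Omega>}"

text \<open>The closure of the test functions in \<open>W1p p \<Omega>\<close>.\<close>
definition W01p :: "real \<Rightarrow> 'a::euclidean_space set \<Rightarrow> ('a \<Rightarrow> real) set" where
  "W01p p \<Omega> = {u \<in> W1p p \<Omega>. \<exists>\<phi>. (\<forall>n. \<phi> n \<in> test_functions \<Omega>) \<and>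
     (\<lambda>n. Lp_norm p \<Omega> (\<lambda>x. u x - \<phi> n x)) \<longlonglongrightarrow> 0 \<and>
     (\<lambda>n. Lp_norm p \<Omega> (\<lambda>x. wgrad \<Omega> u x - grad (\<phi> n) x)) \<longlonglongrightarrow> 0}"

text \<open>
  The dual of \<open>W01p p \<Omega>\<close>, normed by \<open>\<parallel>\<nabla>u\<parallel>\<^sub>p\<close>; the pairing of \<open>f\<close> with \<open>u\<close> is the application \<open>f u\<close>.
  Linearity and boundedness force \<open>f\<close> to agree on functions that are equal almost everywhere.
  The values of \<open>f\<close> outside \<open>W01p p \<Omega>\<close> are irrelevant.
\<close>
definition W01p_dual :: "real \<Rightarrow> 'a::euclidean_space set \<Rightarrow> (('a \<Rightarrow> real) \<Rightarrow> real) set" where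
  "W01p_dual p \<Omega> = {f.
     (\<forall>u\<in>W01p p \<Omega>. \<forall>v\<in>W01p p \<Omega>. f (\<lambda>x. u x + v x) = f u + f v) \<and>
     (\<forall>u\<in>W01p p \<Omega>. \<forall>c. f (\<lambda>x. c * u x) = c * f u) \<and>
     (\<exists>C. \<forall>u\<in>W01p p \<Omega>. \<bar>f u\<bar> \<le> C * Lp_norm p \<Omega> (wgrad \<Omega> u))}"

definition weakly_nonneg ::
    "real \<Rightarrow> 'a::euclidean_space set \<Rightarrow> (('a \<Rightarrow> real) \<Rightarrow> real) \<Rightarrow> bool" where
  "weakly_nonneg p \<Omega> f \<longleftrightarrow> (\<forall>u\<in>W01p p \<Omega>. ae_nonneg \<Omega> u \<longrightarrow> f u \<ge> 0)"

section \<open>The problem and its critical values\<close>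

text \<open>
  Since \<open>0 powr a = 0\<close>, the expressions \<open>\<bar>z\<bar> powr (r - 2) *\<^sub>R z\<close> vanish at \<open>z = 0\<close> for every \<open>r\<close>,
  as usual for \<open>r > 1\<close>.
\<close>
definition weak_solution ::
    "real \<Rightarrow> real \<Rightarrow> 'a::euclidean_space set \<Rightarrow> real \<Rightarrow> real \<Rightarrow> (('a \<Rightarrow> real) \<Rightarrow> real) \<Rightarrow>
     ('a \<Rightarrow> real) \<Rightarrow> bool" where
  "weak_solution p q \<Omega> \<alpha> \<beta> f u \<longleftrightarrow> u \<in> W01p p \<Omega> \<and> (\<forall>\<phi>\<in>W01p p \<Omega>.
     (LINT x|lebesgue_on \<Omega>.
        (norm (wgrad \<Omega> u x) powr (p - 2) + norm (wgrad \<Omega> u x) powr (q - 2)) *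
        (wgrad \<Omega> u x \<bullet> wgrad \<Omega> \<phi> x)) =
     (LINT x|lebesgue_on \<Omega>.
        (\<alpha> * \<bar>u x\<bar> powr (p - 2) * u x + \<beta> * \<bar>u x\<bar> powr (q - 2) * u x) * \<phi> x) + f \<phi>)"

definition pos_part :: "('a \<Rightarrow> real) \<Rightarrow> 'a \<Rightarrow> real" where
  "pos_part u x = max (u x) 0"

text \<open>The negative part is nonpositive, so that \<open>u = pos_part u + neg_part u\<close>.\<close>
definition neg_part :: "('a \<Rightarrow> real) \<Rightarrow> 'a \<Rightarrow> real" where
  "neg_part u x = min (u x) 0"

definition H :: "real \<Rightarrow> 'a::euclidean_space set \<Rightarrow> real \<Rightarrow> ('a \<Rightarrow> real) \<Rightarrow> real" where
  "H p \<Omega> \<alpha> u = Lp_norm p \<Omega> (wgrad \<Omega> u) powr p - \<alpha> * Lp_norm p \<Omega> u powr p"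

text \<open>The infima and supremum below are taken in the extended reals.\<close>

definition lambda1 :: "real \<Rightarrow> 'a::euclidean_space set \<Rightarrow> ereal" where
  "lambda1 p \<Omega> = (INF u\<in>{u \<in> W01p p \<Omega>. \<not> ae_zero \<Omega> u}.
     ereal (Lp_norm p \<Omega> (wgrad \<Omega> u) powr p / Lp_norm p \<Omega> u powr p))"

text \<open>
  The sign \<open>s\<close> is \<open>1\<close> for \<open>\<Phi>\<^sup>+\<close>, \<open>\<B>\<^sup>+\<close> and \<open>-1\<close> for \<open>\<Phi>\<^sup>-\<close>, \<open>\<B>\<^sup>-\<close>. For \<open>f\<close> weakly nonnegative, the bases
  of the real powers in \<open>Phi s\<close> are nonnegative on \<open>B s\<close>.
\<close>
definition Phi ::
    "real \<Rightarrow> real \<Rightarrow> real \<Rightarrow> 'a::euclidean_space set \<Rightarrow> (('a \<Rightarrow> real) \<Rightarrow> real) \<Rightarrow> real \<Rightarrow>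
     ('a \<Rightarrow> real) \<Rightarrow> real" where
  "Phi s p q \<Omega> f \<alpha> u =
     Lp_norm q \<Omega> (wgrad \<Omega> u) powr q / Lp_norm q \<Omega> u powr q
     + s * ((p - 1) / (p - q) * ((p - q) / (q - 1)) powr ((q - 1) / (p - 1)) *
         ((s * H p \<Omega> \<alpha> u) powr ((q - 1) / (p - 1)) * f u powr ((p - q) / (p - 1))
           / Lp_norm q \<Omega> u powr q))"

definition B :: "real \<Rightarrow> real \<Rightarrow> 'a::euclidean_space set \<Rightarrow> real \<Rightarrow> ('a \<Rightarrow> real) set" where
  "B s p \<Omega> \<alpha> = {u \<in> W01p p \<Omega>. \<not> ae_zero \<Omega> u \<and> ae_nonneg \<Omega> u \<and> s * H p \<Omega> \<alpha> u \<ge> 0}"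

definition beta_lower ::
    "real \<Rightarrow> real \<Rightarrow> 'a::euclidean_space set \<Rightarrow> (('a \<Rightarrow> real) \<Rightarrow> real) \<Rightarrow> real \<Rightarrow> ereal" where
  "beta_lower p q \<Omega> f \<alpha> = (INF u\<in>B 1 p \<Omega> \<alpha>. ereal (Phi 1 p q \<Omega> f \<alpha> u))"

definition beta_upper ::
    "real \<Rightarrow> real \<Rightarrow> 'a::euclidean_space set \<Rightarrow> (('a \<Rightarrow> real) \<Rightarrow> real) \<Rightarrow> real \<Rightarrow> ereal" where
  "beta_upper p q \<Omega> f \<alpha> = (SUP u\<in>B (-1) p \<Omega> \<alpha>. ereal (Phi (-1) p q \<Omega> f \<alpha> u))"

end

theory Submission
  imports Defs
begin

text \<open>
  Write \<open>w\<close> for one of the nonnegative functions \<open>max u 0\<close> and \<open>max (- u) 0\<close>, and put \<open>s = 1\<close> in the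
  first case, \<open>s = -1\<close> in the second. On the set where \<open>s u > 0\<close> the gradient of \<open>w\<close> is \<open>s \<nabla>u\<close>, and
  elsewhere it vanishes, so testing the equation with \<open>w\<close> gives the energy identity
  \<open>H w + \<parallel>\<nabla>w\<parallel>\<^sub>q\<^sup>q - \<beta> \<parallel>w\<parallel>\<^sub>q\<^sup>q = s f(w)\<close> (lemma \<open>weak_solution_signed_part_energy\<close>), in which
  \<open>f(w) \<ge> 0\<close>. Suppose that the asserted sign of \<open>H\<close> fails. Then, in both cases,
  \<open>X = - s H w \<ge> 0\<close>, so \<open>w\<close> competes in the infimum or supremum that defines the critical value. The
  constant in \<open>\<Phi>\<^sup>\<plusminus>\<close> is exactly the one for which Young's inequality, with the conjugate weights
  \<open>(q - 1)/(p - 1)\<close> and \<open>(p - q)/(p - 1)\<close>, bounds the modulus of the last term of \<open>\<Phi>\<^sup>\<plusminus>\<close>,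
  multiplied by \<open>\<parallel>w\<parallel>\<^sub>q\<^sup>q\<close>, by \<open>X + f(w)\<close> (lemma \<open>Young_Phi_constant\<close>). Hence \<open>\<beta> < \<Phi>\<^sup>+(w)\<close>, respectively
  \<open>\<beta> > \<Phi>\<^sup>-(w)\<close>, turns into a strict inequality that contradicts the identity.

  The remaining work is to justify the test function: \<open>w\<close> must lie in \<open>W01p p \<Omega>\<close> and have the
  gradient described above (lemma \<open>pos_part_W01p\<close>). Everything is done with pairs
  \<open>(u, g)\<close> that are \<open>L\<^sup>p\<close>-limits of pairs \<open>(\<phi>, \<nabla>\<phi>)\<close> with \<open>\<phi>\<close> a test function. A smooth \<open>h\<close> with
  bounded derivative and \<open>h 0 = 0\<close> maps test functions to test functions, so these pairs are
  stable under \<open>(u, g) \<mapsto> (h \<circ> u, h' (u) g)\<close>, and by dominated convergence also under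
  pointwise limits of such \<open>h\<close> and \<open>h'\<close> (lemma \<open>sobolev_pair_limit_compose\<close>). Integration by parts for test functions shows that \<open>g\<close> is a weak gradient of \<open>u\<close>, and
  uniqueness of weak gradients (lemma \<open>weak_gradient_unique\<close>) identifies \<open>g\<close> with
  \<open>wgrad \<Omega> u\<close>.

  Smooth approximations of the positive part leave the factor \<open>1/2\<close> at the origin. This does no harm
  because the gradient vanishes almost everywhere on \<open>{u = 0}\<close> (lemma \<open>wgrad_zero_on_zero_set\<close>):
  functions \<open>h\<close> that tend to \<open>0\<close> while \<open>h'\<close> tends to the indicator of \<open>{0}\<close> exhibit the restriction
  of the gradient to that set as a weak gradient of the zero function.
\<close>

section \<open>Calculus of smooth functions\<close>

lemma Ck_SucI:
  assumes "\<And>x. (\<phi> has_derivative \<phi>' x) (at x)" "\<And>b. b \<in> Basis \<Longrightarrow> Ck k (\<lambda>x. \<phi>' x b)"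
  shows "Ck (Suc k) \<phi>"
proof -
  have "frechet_derivative \<phi> (at x) = \<phi>' x" for x
    using frechet_derivative_at[OF assms(1)] by simp
  then show ?thesis using assms by (auto simp: differentiable_def)
qed

lemma Ck_Suc_has_derivative:
  "Ck (Suc k) \<phi> \<Longrightarrow> (\<phi> has_derivative frechet_derivative \<phi> (at x)) (at x)"
  by (simp add: frechet_derivative_works[symmetric])

lemma Ck_Suc_imp_Ck: "Ck (Suc k) \<phi> \<Longrightarrow> Ck k \<phi>"
proof (induction k arbitrary: \<phi>)
  case 0
  then show ?case
    by (auto simp: continuous_on_eq_continuous_within intro: differentiable_imp_continuous_within)
next
  case (Suc k)
  then show ?case by (metis Ck.simps(2))
qed

lemma Ck_imp_continuous_on: "Ck k \<phi> \<Longrightarrow> continuous_on S \<phi>"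
proof (induction k)
  case 0
  then show ?case using continuous_on_subset by auto
next
  case (Suc k)
  then show ?case using Ck_Suc_imp_Ck by blast
qed

lemma Ck_const: "Ck k (\<lambda>x::'a::euclidean_space. c)"
proof (induction k arbitrary: c)
  case (Suc k)
  show ?case by (rule Ck_SucI[where \<phi>'="\<lambda>x y. 0"]) (use Suc in auto)
qed simp

lemma Ck_inner_left: "Ck k (\<lambda>x::'a::euclidean_space. x \<bullet> a)"
proof (cases k)
  case (Suc k)
  show ?thesis unfolding Suc
    by (rule Ck_SucI[where \<phi>'="\<lambda>x y. y \<bullet> a"]) (auto simp: Ck_const intro!: derivative_eq_intros)
qed (auto intro!: continuous_intros)

lemma Ck_add:
  "Ck k \<phi> \<Longrightarrow> Ck k \<psi> \<Longrightarrow> Ck k (\<lambda>x. \<phi> x + \<psi> x)"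
proof (induction k arbitrary: \<phi> \<psi>)
  case (Suc k)
  show ?case
    by (rule Ck_SucI[OF has_derivative_add[OF Suc.prems[THEN Ck_Suc_has_derivative]]])
       (use Suc in auto)
qed (auto intro!: continuous_intros)

lemma Ck_mult:
  "Ck k \<phi> \<Longrightarrow> Ck k \<psi> \<Longrightarrow> Ck k (\<lambda>x. \<phi> x * \<psi> x)"
proof (induction k arbitrary: \<phi> \<psi>)
  case (Suc k)
  show ?case
    by (rule Ck_SucI[OF has_derivative_mult[OF Suc.prems[THEN Ck_Suc_has_derivative]]])
       (use Suc.prems[THEN Ck_Suc_imp_Ck] Suc in \<open>auto intro!: Ck_add\<close>)
qed (auto intro!: continuous_intros)

lemma Ck_diff:
  "Ck k \<phi> \<Longrightarrow> Ck k \<psi> \<Longrightarrow> Ck k (\<lambda>x. \<phi> x - \<psi> x)"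
  using Ck_add[of k \<phi> "\<lambda>x. (-1) * \<psi> x"] Ck_mult[OF Ck_const[of k "-1"], of \<psi>] by simp

lemma Ck_prod:
  "finite I \<Longrightarrow> (\<And>i. i \<in> I \<Longrightarrow> Ck k (\<phi> i)) \<Longrightarrow> Ck k (\<lambda>x. \<Prod>i\<in>I. \<phi> i x)"
proof (induction I rule: finite_induct)
  case empty
  show ?case by (simp add: Ck_const)
next
  case (insert i I)
  then show ?case by (simp add: Ck_mult)
qed

lemma Ck_real_SucI:
  fixes h :: "real \<Rightarrow> real"
  assumes "\<And>t. (h has_real_derivative h' t) (at t)" "Ck k h'"
  shows "Ck (Suc k) h"
  by (rule Ck_SucI[where \<phi>'="\<lambda>x y. h' x * y"]) (use assms in \<open>auto simp: has_field_derivative_def\<close>)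

lemma Ck_compose:
  fixes h :: "real \<Rightarrow> real" and \<phi> :: "'a::euclidean_space \<Rightarrow> real"
  shows "Ck k h \<Longrightarrow> Ck k \<phi> \<Longrightarrow> Ck k (\<lambda>x. h (\<phi> x))"
proof (induction k arbitrary: h \<phi>)
  case 0
  then show ?case by (auto intro: continuous_on_compose2)
next
  case (Suc k)
  have h: "(h has_derivative frechet_derivative h (at y)) (at y)" for y
    using Suc.prems(1) by (rule Ck_Suc_has_derivative)
  have *: "frechet_derivative h (at y) c = frechet_derivative h (at y) 1 * c" for y c
    using linear_cmul[OF has_derivative_linear[OF h], of y c 1] by simp
  show ?case
  proof (rule Ck_SucI)
    show "((\<lambda>x. h (\<phi> x)) has_derivative
        (\<lambda>b. frechet_derivative h (at (\<phi> x)) (frechet_derivative \<phi> (at x) b))) (at x)" for x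
      using has_derivative_compose[OF Ck_Suc_has_derivative[OF Suc.prems(2)] h] .
    fix b :: 'a assume "b \<in> Basis"
    then have "Ck k (\<lambda>x. frechet_derivative \<phi> (at x) b)"
      using Suc.prems by simp
    moreover have "Ck k (\<lambda>x. frechet_derivative h (at (\<phi> x)) 1)"
      using Suc.prems by (intro Suc.IH[OF _ Ck_Suc_imp_Ck]) auto
    ultimately have "Ck k (\<lambda>x. frechet_derivative h (at (\<phi> x)) 1 * frechet_derivative \<phi> (at x) b)"
      by (intro Ck_mult)
    moreover have "(\<lambda>x. frechet_derivative h (at (\<phi> x)) (frechet_derivative \<phi> (at x) b)) =
        (\<lambda>x. frechet_derivative h (at (\<phi> x)) 1 * frechet_derivative \<phi> (at x) b)"
      by (rule ext) (rule *)
    ultimately show "Ck k (\<lambda>x. frechet_derivative h (at (\<phi> x)) (frechet_derivative \<phi> (at x) b))"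
      by metis
  qed
qed

section \<open>Bump functions supported in boxes\<close>

text \<open>
  For \<open>m = 0\<close> this is the classical smooth function that is flat at the origin. The extra negative
  powers make the family closed under differentiation, which lets smoothness be proved by induction.
\<close>
definition flat_exp :: "real \<Rightarrow> nat \<Rightarrow> real \<Rightarrow> real" where
  "flat_exp c m t = (if t > 0 then exp (- c / t) / t ^ m else 0)"

text \<open>
  Substituting \<open>t = 1 / s\<close>, the exponential beats every power. All derivatives at the origin vanish
  for this reason.
\<close>
lemma flat_exp_tendsto_0:
  assumes "c > 0"
  shows "(flat_exp c m \<longlongrightarrow> 0) (at 0)"
proof -
  have "((\<lambda>s. s ^ m / exp (c * s)) \<longlongrightarrow> 0) at_top"
  proof -
    have "filterlim (\<lambda>s. c * s) at_top at_top"
      using assms by (intro filterlim_tendsto_pos_mult_at_top[OF tendsto_const]) (auto intro: filterlim_ident)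
    then have "((\<lambda>s. (c * s) ^ m / exp (c * s)) \<longlongrightarrow> 0) at_top"
      by (rule filterlim_compose[OF tendsto_power_div_exp_0])
    then have "((\<lambda>s. (1 / c ^ m) * ((c * s) ^ m / exp (c * s))) \<longlongrightarrow> 0) at_top"
      by (rule tendsto_mult_right_zero)
    then show ?thesis using assms by (simp add: power_mult_distrib)
  qed
  then have "((\<lambda>t. (inverse t) ^ m / exp (c * inverse t)) \<longlongrightarrow> 0) (at_right 0)"
    by (rule filterlim_compose[OF _ filterlim_inverse_at_top_right])
  moreover have "\<forall>\<^sub>F t in at_right 0. (inverse t) ^ m / exp (c * inverse t) = flat_exp c m t"
    using eventually_at_right_less[of "0::real"]
    by eventually_elim (simp add: flat_exp_def exp_minus field_simps)
  ultimately have "(flat_exp c m \<longlongrightarrow> 0) (at_right 0)"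
    using tendsto_cong by fast
  moreover have "\<forall>\<^sub>F t in at_left 0. flat_exp c m t = 0"
    by (auto simp: eventually_at_filter flat_exp_def)
  then have "(flat_exp c m \<longlongrightarrow> 0) (at_left 0)"
    by (rule tendsto_eventually)
  ultimately show ?thesis using filterlim_split_at by blast
qed

lemma flat_exp_has_real_derivative:
  assumes "c > 0"
  shows "(flat_exp c m has_real_derivative c * flat_exp c (m + 2) t - m * flat_exp c (m + 1) t) (at t)"
proof -
  consider "t > 0" | "t < 0" | "t = 0" by linarith
  then show ?thesis
  proof cases
    case 1
    have "((\<lambda>t. exp (- c / t) / t ^ m) has_real_derivative
        (exp (- c / t) * (c / t\<^sup>2) * t ^ m - exp (- c / t) * (m * t ^ (m - 1))) / (t ^ m * t ^ m)) (at t)"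
      using 1 by (auto intro!: derivative_eq_intros simp: power2_eq_square)
    moreover have "m * t ^ (m - 1) = m * t ^ m / t"
      using 1 by (cases m) auto
    then have "(exp (- c / t) * (c / t\<^sup>2) * t ^ m - exp (- c / t) * (m * t ^ (m - 1))) / (t ^ m * t ^ m)
        = c * flat_exp c (m + 2) t - m * flat_exp c (m + 1) t"
      using 1 by (simp add: flat_exp_def) (simp add: field_simps power2_eq_square)
    ultimately have "((\<lambda>t. exp (- c / t) / t ^ m) has_real_derivative
        c * flat_exp c (m + 2) t - m * flat_exp c (m + 1) t) (at t)"
      by metis
    then show ?thesis
      by (rule has_field_derivative_transform_within_open[where S="{0<..}"])
         (use 1 in \<open>auto simp: flat_exp_def\<close>)
  next
    case 2
    have "((\<lambda>t. 0) has_real_derivative 0) (at t)" by simp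
    then have "(flat_exp c m has_real_derivative 0) (at t)"
      by (rule has_field_derivative_transform_within_open[where S="{..<0}"])
         (use 2 in \<open>auto simp: flat_exp_def\<close>)
    with 2 show ?thesis by (simp add: flat_exp_def)
  next
    case 3
    have "((\<lambda>h. (flat_exp c m (0 + h) - flat_exp c m 0) / h) \<longlongrightarrow> 0) (at 0)"
      using flat_exp_tendsto_0[OF assms, of "m + 1"]
      by (rule Lim_transform_eventually)
         (auto simp: flat_exp_def eventually_at_filter field_simps)
    then have "(flat_exp c m has_real_derivative 0) (at 0)"
      by (simp add: DERIV_def)
    with 3 show ?thesis by (simp add: flat_exp_def)
  qed
qed

lemma Ck_flat_exp: "c > 0 \<Longrightarrow> Ck k (flat_exp c m)"
proof (induction k arbitrary: m)
  case 0
  show ?case unfolding Ck.simps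
    by (rule DERIV_continuous_on[OF has_field_derivative_at_within[OF flat_exp_has_real_derivative[OF 0]]])
next
  case (Suc k)
  show ?case
    by (rule Ck_real_SucI[OF flat_exp_has_real_derivative[OF Suc.prems]])
       (intro Ck_diff Ck_mult Ck_const Suc)
qed

definition box_bump :: "real \<Rightarrow> 'a::euclidean_space \<Rightarrow> 'a \<Rightarrow> 'a \<Rightarrow> real" where
  "box_bump c a b x = (\<Prod>i\<in>Basis. flat_exp c 0 (x \<bullet> i - a \<bullet> i) * flat_exp c 0 (b \<bullet> i - x \<bullet> i))"

lemma box_bump_eq_0_iff: "box_bump c a b x = 0 \<longleftrightarrow> x \<notin> box a b"
proof -
  have "flat_exp c 0 t = 0 \<longleftrightarrow> t \<le> 0" for t by (simp add: flat_exp_def)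
  then have "box_bump c a b x = 0 \<longleftrightarrow> (\<exists>i\<in>Basis. x \<bullet> i \<le> a \<bullet> i \<or> b \<bullet> i \<le> x \<bullet> i)"
    by (simp add: box_bump_def)
  also have "\<dots> \<longleftrightarrow> x \<notin> box a b" by (auto simp: mem_box not_less)
  finally show ?thesis .
qed

lemma box_bump_test_function:
  assumes "c > 0" "cbox a b \<subseteq> \<Omega>"
  shows "box_bump c a b \<in> test_functions \<Omega>"
proof -
  have "closure {x. box_bump c a b x \<noteq> 0} \<subseteq> cbox a b"
    by (rule closure_minimal) (use box_subset_cbox in \<open>auto simp: box_bump_eq_0_iff\<close>)
  moreover have "Ck k (box_bump c a b)" for k
    unfolding box_bump_def[abs_def]
    using assms by (intro Ck_prod Ck_mult Ck_compose[OF Ck_flat_exp[OF assms(1)]] Ck_diff Ck_inner_left Ck_const finite_Basis)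
  ultimately show ?thesis
    using assms compact_cbox[of a b] closed_closure[of "{x. box_bump c a b x \<noteq> 0}"]
      closed_Int_compact[of "closure {x. box_bump c a b x \<noteq> 0}" "cbox a b"]
    unfolding test_functions_def by (simp add: inf_absorb1)
qed

lemma abs_box_bump_le: 
  assumes "c > 0" shows "\<bar>box_bump c a b x\<bar> \<le> indicator (box a b) x"
proof (cases "x \<in> box a b")
  case True
  have "0 \<le> flat_exp c 0 t" "flat_exp c 0 t \<le> 1" for t using assms by (auto simp: flat_exp_def)
  then have "0 \<le> box_bump c a b x \<and> box_bump c a b x \<le> 1" unfolding box_bump_def
    by (intro conjI prod_nonneg prod_le_1) (auto intro: mult_le_one)
  then show ?thesis using True by simp
next
  case False
  then show ?thesis using box_bump_eq_0_iff[of c a b x] by simp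
qed

text \<open>
  As \<open>c\<close> tends to \<open>0\<close>, each factor \<open>exp (- c / t)\<close> with \<open>t > 0\<close> tends to \<open>1\<close>. Indicators of boxes are
  thus bounded limits of test functions with a common support.
\<close>
lemma box_bump_tendsto_indicator:
  "(\<lambda>n. box_bump (1 / real (Suc n)) a b x) \<longlonglongrightarrow> indicator (box a b) x"
proof (cases "x \<in> box a b")
  case True
  have *: "(\<lambda>n. flat_exp (1 / real (Suc n)) 0 t) \<longlonglongrightarrow> 1" if "t > 0" for t
  proof -
    have "(\<lambda>n. exp (- (1 / real (Suc n)) / t)) \<longlonglongrightarrow> exp (- 0 / t)"
      using that by (intro tendsto_intros LIMSEQ_Suc[OF lim_1_over_n]) auto
    then show ?thesis using that by (simp add: flat_exp_def)
  qed
  have "(\<lambda>n. box_bump (1 / real (Suc n)) a b x) \<longlonglongrightarrow> (\<Prod>i\<in>(Basis::'a set). 1 * 1)"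
    unfolding box_bump_def using True by (intro tendsto_intros *) (auto simp: mem_box)
  then show ?thesis using True by simp
next
  case False
  then show ?thesis using box_bump_eq_0_iff[of _ a b x] by simp
qed

section \<open>Uniqueness of weak gradients\<close>

lemma open_imp_sets_lebesgue: "open S \<Longrightarrow> S \<in> sets lebesgue"
  by (simp add: borel_open sets_completionI_sets)

lemma compact_imp_sets_lebesgue: "compact S \<Longrightarrow> S \<in> sets lebesgue"
  by (simp add: borel_compact sets_completionI_sets)

text \<open>
  Lebesgue's differentiation theorem recovers \<open>g\<close> almost everywhere from its averages over small
  cubes. It is applied to the restriction of \<open>g\<close> to one box at a time, as \<open>g\<close> is integrable only
  locally. Countably many boxes cover the open set.
\<close>
lemma AE_zero_if_cbox_integrals_zero:
  fixes g :: "'a::euclidean_space \<Rightarrow> real"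
  assumes "open \<Omega>" "locally_integrable \<Omega> g"
    and zero: "\<And>a b. cbox a b \<subseteq> \<Omega> \<Longrightarrow> (LINT x|lebesgue_on (cbox a b). g x) = 0"
  shows "AE x in lebesgue_on \<Omega>. g x = 0"
proof -
  obtain \<D> where \<D>: "countable \<D>" "\<D> \<subseteq> Pow \<Omega>" "\<And>X. X \<in> \<D> \<Longrightarrow> \<exists>a b. X = cbox a b" "\<Union>\<D> = \<Omega>"
    using open_countable_Union_open_cbox[OF \<open>open \<Omega>\<close>] by blast
  have "negligible {x \<in> X. g x \<noteq> 0}" if XD: "X \<in> \<D>" for X
  proof -
    obtain a b where X: "X = cbox a b" and sub: "cbox a b \<subseteq> \<Omega>"
      using \<D>(2) \<D>(3)[OF XD] XD by auto
    define f where "f = (\<lambda>x. if x \<in> cbox a b then g x else 0)"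
    have gi: "integrable (lebesgue_on (cbox a b)) g"
      using assms(2) sub by (simp add: locally_integrable_def)
    have fi: "integrable lebesgue f"
    proof -
      have "(\<lambda>x. indicator (cbox a b) x *\<^sub>R g x) = f"
        by (auto simp: f_def fun_eq_iff)
      then show ?thesis using gi by (simp add: integrable_restrict_space del: real_scaleR_def)
    qed
    have int_f: "integral (cbox c d) f = 0" for c d
    proof -
      obtain a' b' where *: "cbox a b \<inter> cbox c d = cbox a' b'" using Int_interval by blast
      then have sub': "cbox a' b' \<subseteq> cbox a b" by blast
      then have "integrable (lebesgue_on (cbox a' b')) g"
        using assms(2) sub by (simp add: locally_integrable_def)
      then have "integral (cbox a' b') g = 0"
        using zero[of a' b'] sub sub' lebesgue_integral_eq_integral[of "cbox a' b'" g] by auto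
      then show ?thesis
        unfolding f_def using Henstock_Kurzweil_Integration.integral_restrict_Int * by metis
    qed
    have "f integrable_on cbox c d" for c d
      using integrable_on_lebesgue[OF fi] integrable_on_subcbox by blast
    then obtain N where N: "negligible N" and lim: "\<And>x e. \<lbrakk>x \<notin> N; 0 < e\<rbrakk> \<Longrightarrow>
        \<exists>d>0. \<forall>h. 0 < h \<and> h < d \<longrightarrow>
          norm (integral (cbox x (x + h *\<^sub>R One)) f /\<^sub>R h ^ DIM('a) - f x) < e"
      using integrable_ccontinuous_explicit[of f] by blast
    have "f x = 0" if xN: "x \<notin> N" for x
    proof (rule ccontr)
      assume "f x \<noteq> 0"
      then have "\<exists>d>0::real. \<forall>h. 0 < h \<and> h < d \<longrightarrow> norm (f x) < norm (f x)"
        using lim[OF xN, of "norm (f x)"] by (simp add: int_f)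
      then obtain d :: real where "d > 0" and d: "\<forall>h. 0 < h \<and> h < d \<longrightarrow> norm (f x) < norm (f x)"
        by blast
      then show False using d[rule_format, of "d / 2"] by simp
    qed
    then have "{x \<in> X. g x \<noteq> 0} \<subseteq> N" by (force simp: X f_def)
    then show ?thesis using N negligible_subset by blast
  qed
  then have "negligible (\<Union>X\<in>\<D>. {x \<in> X. g x \<noteq> 0})"
    using \<D>(1) by (intro negligible_countable_Union) auto
  then have "(\<Union>X\<in>\<D>. {x \<in> X. g x \<noteq> 0}) \<in> null_sets lebesgue"
    by (simp add: negligible_iff_null_sets)
  then have "AE x in lebesgue. x \<in> \<Omega> \<longrightarrow> g x = 0"
    by (rule AE_I') (use \<D>(4) in auto)
  then show ?thesis
    using open_imp_sets_lebesgue[OF \<open>open \<Omega>\<close>] by (subst AE_restrict_space_iff) auto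
qed

lemma integrable_lebesgue_on_indicator:
  fixes g :: "'a::euclidean_space \<Rightarrow> real"
  assumes "S \<in> sets lebesgue" "K \<in> sets lebesgue" "K \<subseteq> S"
  shows "integrable (lebesgue_on S) (\<lambda>x. indicator K x * g x) \<longleftrightarrow> integrable (lebesgue_on K) g"
    and "(LINT x|lebesgue_on S. indicator K x * g x) = (LINT x|lebesgue_on K. g x)"
proof -
  have *: "(\<lambda>x. indicator S x *\<^sub>R (indicator K x * g x)) = (\<lambda>x. indicator K x *\<^sub>R g x)"
    using assms(3) by (auto simp: fun_eq_iff split: split_indicator)
  show "integrable (lebesgue_on S) (\<lambda>x. indicator K x * g x) \<longleftrightarrow> integrable (lebesgue_on K) g"
    using assms(1,2) by (simp add: integrable_restrict_space * del: real_scaleR_def)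
  show "(LINT x|lebesgue_on S. indicator K x * g x) = (LINT x|lebesgue_on K. g x)"
    using assms(1,2) by (simp add: integral_restrict_space * del: real_scaleR_def)
qed

lemma continuous_imp_measurable_lebesgue_on:
  "continuous_on UNIV f \<Longrightarrow> f \<in> borel_measurable (lebesgue_on S)"
  by (intro measurable_restrict_space1 measurable_completion)
     (simp add: borel_measurable_continuous_onI)

text \<open>
  The fundamental lemma of the calculus of variations. Bump functions converge boundedly to the
  indicator of a box, so the integrals of \<open>g\<close> over boxes vanish.
\<close>
lemma AE_zero_if_test_integrals_zero:
  fixes g :: "'a::euclidean_space \<Rightarrow> real"
  assumes "open \<Omega>" and g: "locally_integrable \<Omega> g"
    and zero: "\<And>\<phi>. \<phi> \<in> test_functions \<Omega> \<Longrightarrow> (LINT x|lebesgue_on \<Omega>. g x * \<phi> x) = 0"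
  shows "AE x in lebesgue_on \<Omega>. g x = 0"
proof (rule AE_zero_if_cbox_integrals_zero[OF \<open>open \<Omega>\<close> g])
  fix a b :: 'a assume sub: "cbox a b \<subseteq> \<Omega>"
  \<comment> \<open>Restricting to the box makes \<open>g\<close> integrable, hence measurable, on the whole of \<open>\<Omega>\<close>.\<close>
  define G where "G x = indicator (cbox a b) x * g x" for x
  note \<Omega> = open_imp_sets_lebesgue[OF \<open>open \<Omega>\<close>]
  have "integrable (lebesgue_on (cbox a b)) g"
    using g sub by (simp add: locally_integrable_def)
  then have G: "integrable (lebesgue_on \<Omega>) G"
    using \<Omega> sub by (simp add: G_def[abs_def] integrable_lebesgue_on_indicator)
  have gG: "g x * box_bump c a b x = G x * box_bump c a b x" for c x
    using box_bump_eq_0_iff[of c a b x] box_subset_cbox[of a b]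
    by (auto simp: G_def indicator_def)
  have meas: "box_bump c a b \<in> borel_measurable (lebesgue_on \<Omega>)" if "c > 0" for c
    using box_bump_test_function[OF that sub]
    by (intro continuous_imp_measurable_lebesgue_on Ck_imp_continuous_on[where k=0]) (simp add: test_functions_def)
  have ind: "(indicator (box a b) :: 'a \<Rightarrow> real) \<in> borel_measurable (lebesgue_on \<Omega>)"
    by (intro measurable_restrict_space1 borel_measurable_indicator open_imp_sets_lebesgue open_box)
  have "(\<lambda>n. LINT x|lebesgue_on \<Omega>. G x * box_bump (1 / real (Suc n)) a b x)
      \<longlonglongrightarrow> (LINT x|lebesgue_on \<Omega>. G x * indicator (box a b) x)"
  proof (rule integral_dominated_convergence[where w="\<lambda>x. \<bar>G x\<bar>"])
    show "(\<lambda>x. G x * indicator (box a b) x) \<in> borel_measurable (lebesgue_on \<Omega>)"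
      using G ind by (intro borel_measurable_times) auto
    show "(\<lambda>x. G x * box_bump (1 / real (Suc n)) a b x) \<in> borel_measurable (lebesgue_on \<Omega>)" for n
      using G meas[of "1 / real (Suc n)"] by auto
    show "AE x in lebesgue_on \<Omega>. (\<lambda>n. G x * box_bump (1 / real (Suc n)) a b x)
        \<longlonglongrightarrow> G x * indicator (box a b) x"
      by (intro AE_I2 tendsto_mult tendsto_const box_bump_tendsto_indicator)
    show "AE x in lebesgue_on \<Omega>. norm (G x * box_bump (1 / real (Suc n)) a b x) \<le> \<bar>G x\<bar>" for n
    proof (rule AE_I2)
      fix x
      have "\<bar>box_bump (1 / real (Suc n)) a b x\<bar> \<le> 1"
        using abs_box_bump_le[of "1 / real (Suc n)" a b x]
        by (cases "x \<in> box a b") auto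
      then show "norm (G x * box_bump (1 / real (Suc n)) a b x) \<le> \<bar>G x\<bar>"
        by (simp add: abs_mult mult_left_le)
    qed
  qed (use G in auto)
  moreover have "(LINT x|lebesgue_on \<Omega>. G x * box_bump (1 / real (Suc n)) a b x) = 0" for n
    using zero[OF box_bump_test_function[OF _ sub, of "1 / real (Suc n)"]] by (simp add: gG)
  ultimately have "(LINT x|lebesgue_on \<Omega>. G x * indicator (box a b) x) = 0"
    using LIMSEQ_unique[of "\<lambda>n. 0 :: real" _ 0] by auto
  moreover have "(LINT x|lebesgue_on \<Omega>. G x * indicator (box a b) x) = (LINT x|lebesgue_on \<Omega>. G x)"
  proof (rule integral_cong_AE)
    show "(\<lambda>x. G x * indicator (box a b) x) \<in> borel_measurable (lebesgue_on \<Omega>)"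
      using G ind by (intro borel_measurable_times) auto
    have "cbox a b - box a b \<in> null_sets lebesgue"
      using negligible_frontier_interval negligible_iff_null_sets by blast
    then have "AE x in lebesgue. x \<in> \<Omega> \<longrightarrow> G x * indicator (box a b) x = G x"
      by (rule AE_I') (auto simp: G_def indicator_def)
    then show "AE x in lebesgue_on \<Omega>. G x * indicator (box a b) x = G x"
      using \<Omega> by (subst AE_restrict_space_iff) auto
  qed (use G in auto)
  ultimately show "(LINT x|lebesgue_on (cbox a b). g x) = 0"
    using \<Omega> sub by (simp add: G_def[abs_def] integrable_lebesgue_on_indicator)
qed

lemma compact_support_bounded:
  fixes F :: "'a::euclidean_space \<Rightarrow> 'b::real_normed_vector"
  assumes "continuous_on UNIV F" "compact K" "\<And>x. x \<notin> K \<Longrightarrow> F x = 0"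
  obtains M where "M > 0" "\<And>x. norm (F x) \<le> M"
proof -
  have "compact (F ` K)"
    using assms by (meson compact_continuous_image continuous_on_subset subset_UNIV)
  then obtain M where M: "M > 0" "\<forall>y\<in>F ` K. norm y \<le> M"
    using compact_imp_bounded bounded_pos by metis
  show ?thesis
  proof (rule that[OF M(1)])
    show "norm (F x) \<le> M" for x using assms(3)[of x] M by (cases "x \<in> K") auto
  qed
qed

lemma grad_inner_Basis: "b \<in> Basis \<Longrightarrow> grad \<phi> x \<bullet> b = frechet_derivative \<phi> (at x) b"
  by (simp add: grad_def)

lemma Ck_Suc_continuous_on_grad: "Ck (Suc k) \<phi> \<Longrightarrow> continuous_on S (grad \<phi>)"
  unfolding grad_def[abs_def]
  by (intro continuous_intros Ck_imp_continuous_on[of k]) simp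

lemma frechet_derivative_outside_support:
  fixes \<phi> :: "'a::euclidean_space \<Rightarrow> real"
  assumes "x \<notin> closure {x. \<phi> x \<noteq> 0}"
  shows "frechet_derivative \<phi> (at x) = (\<lambda>_. 0)"
proof -
  have "(\<phi> has_derivative (\<lambda>_. 0)) (at x)"
    by (rule has_derivative_transform_within_open[where f="\<lambda>_. 0" and s="- closure {x. \<phi> x \<noteq> 0}"])
       (use assms closure_subset[of "{x. \<phi> x \<noteq> 0}"] in auto)
  then show ?thesis using frechet_derivative_at by metis
qed

text \<open>
  The properties of test functions that the estimates need: a common compact support and a common
  bound for the function and its gradient.
\<close>
lemma test_functionE:
  fixes \<phi> :: "'a::euclidean_space \<Rightarrow> real"
  assumes "\<phi> \<in> test_functions \<Omega>"
  obtains K M where "compact K" "K \<subseteq> \<Omega>" "\<And>x. x \<notin> K \<Longrightarrow> \<phi> x = 0" "\<And>x. x \<notin> K \<Longrightarrow> grad \<phi> x = 0"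
    "M > 0" "\<And>x. \<bar>\<phi> x\<bar> \<le> M" "\<And>x. norm (grad \<phi> x) \<le> M"
    "continuous_on UNIV \<phi>" "continuous_on UNIV (grad \<phi>)"
proof -
  define K where "K = closure {x. \<phi> x \<noteq> 0}"
  have K: "compact K" "K \<subseteq> \<Omega>" and \<phi>: "\<And>k. Ck k \<phi>"
    using assms by (auto simp: test_functions_def K_def)
  note c = Ck_imp_continuous_on[OF \<phi>, of UNIV] Ck_Suc_continuous_on_grad[OF \<phi>, of UNIV]
  have z: "\<phi> x = 0" "grad \<phi> x = 0" if "x \<notin> K" for x
    using that closure_subset[of "{x. \<phi> x \<noteq> 0}"] frechet_derivative_outside_support[of x \<phi>]
    by (auto simp: K_def grad_def)
  obtain M1 where M1: "M1 > 0" "\<And>x. norm (\<phi> x) \<le> M1"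
    using compact_support_bounded[OF c(1) K(1)] z by metis
  obtain M2 where M2: "M2 > 0" "\<And>x. norm (grad \<phi> x) \<le> M2"
    using compact_support_bounded[OF c(2) K(1)] z by metis
  show ?thesis
  proof (rule that[OF K z, of "M1 + M2"])
    show "\<bar>\<phi> x\<bar> \<le> M1 + M2" for x using M1(2)[of x] M2(1) by simp
    show "norm (grad \<phi> x) \<le> M1 + M2" for x using M2(2)[of x] M1(1) by simp
  qed (use c M1 M2 in auto)
qed

lemma integrable_locally_integrable_mult:
  fixes g \<psi> :: "'a::euclidean_space \<Rightarrow> real"
  assumes "open \<Omega>" "locally_integrable \<Omega> g" "compact K" "K \<subseteq> \<Omega>"
    and \<psi>: "continuous_on UNIV \<psi>" "\<And>x. x \<notin> K \<Longrightarrow> \<psi> x = 0"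
  shows "integrable (lebesgue_on \<Omega>) (\<lambda>x. g x * \<psi> x)"
proof -
  obtain M where M: "M > 0" "\<And>x. norm (\<psi> x) \<le> M"
    using compact_support_bounded[OF \<psi>(1) assms(3) \<psi>(2)] by metis
  have gi: "integrable (lebesgue_on K) g"
    using assms by (simp add: locally_integrable_def)
  have "integrable (lebesgue_on K) (\<lambda>x. g x * \<psi> x)"
  proof (rule Bochner_Integration.integrable_bound)
    show "integrable (lebesgue_on K) (\<lambda>x. M * g x)" using gi by simp
    show "(\<lambda>x. g x * \<psi> x) \<in> borel_measurable (lebesgue_on K)"
      using gi continuous_imp_measurable_lebesgue_on[OF \<psi>(1)] by auto
    show "AE x in lebesgue_on K. norm (g x * \<psi> x) \<le> norm (M * g x)"
      using M by (intro AE_I2) (simp add: abs_mult mult.commute mult_right_mono)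
  qed
  then have "integrable (lebesgue_on \<Omega>) (\<lambda>x. indicator K x * (g x * \<psi> x))"
    using assms by (subst integrable_lebesgue_on_indicator)
      (auto intro: open_imp_sets_lebesgue compact_imp_sets_lebesgue)
  moreover have "(\<lambda>x. indicator K x * (g x * \<psi> x)) = (\<lambda>x. g x * \<psi> x)"
    using \<psi>(2) by (auto simp: fun_eq_iff split: split_indicator)
  ultimately show ?thesis by simp
qed

lemma locally_integrable_inner:
  "locally_integrable \<Omega> g \<Longrightarrow> locally_integrable \<Omega> (\<lambda>x. g x \<bullet> b)"
  by (simp add: locally_integrable_def)

lemma integrable_inner_test_function:
  assumes "open \<Omega>" "locally_integrable \<Omega> g" "\<phi> \<in> test_functions \<Omega>"
  shows "integrable (lebesgue_on \<Omega>) (\<lambda>x. (g x \<bullet> b) * \<phi> x)"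
  using assms(3)
proof (rule test_functionE)
  fix K assume "compact K" "K \<subseteq> \<Omega>" "\<And>x. x \<notin> K \<Longrightarrow> \<phi> x = 0" "continuous_on UNIV \<phi>"
  then show ?thesis
    using assms by (intro integrable_locally_integrable_mult[of \<Omega> _ K] locally_integrable_inner)
qed

text \<open>
  Only the class of \<open>u\<close> modulo null sets enters the defining identity. The fundamental lemma applies to
  each of the finitely many components of \<open>g - g'\<close>.
\<close>
lemma weak_gradient_unique:
  assumes "open \<Omega>" and u: "is_weak_gradient \<Omega> u g" and v: "is_weak_gradient \<Omega> v g'"
    and uv: "AE x in lebesgue_on \<Omega>. u x = v x"
  shows "AE x in lebesgue_on \<Omega>. g x = g' x"
proof -
  have loc: "locally_integrable \<Omega> u" "locally_integrable \<Omega> v" "locally_integrable \<Omega> g" "locally_integrable \<Omega> g'"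
    using u v by (auto simp: is_weak_gradient_def)
  have "AE x in lebesgue_on \<Omega>. g x \<bullet> b - g' x \<bullet> b = 0" if b: "b \<in> Basis" for b
  proof (rule AE_zero_if_test_integrals_zero[OF \<open>open \<Omega>\<close>])
    show "locally_integrable \<Omega> (\<lambda>x. g x \<bullet> b - g' x \<bullet> b)"
      using loc by (simp add: locally_integrable_def)
    fix \<phi> assume \<phi>: "\<phi> \<in> test_functions \<Omega>"
    obtain K where K: "compact K" "K \<subseteq> \<Omega>" "\<And>x. x \<notin> K \<Longrightarrow> grad \<phi> x = 0" "continuous_on UNIV (grad \<phi>)"
      using test_functionE[OF \<phi>] by metis
    have ui: "integrable (lebesgue_on \<Omega>) (\<lambda>x. u x * (grad \<phi> x \<bullet> b))"
        "integrable (lebesgue_on \<Omega>) (\<lambda>x. v x * (grad \<phi> x \<bullet> b))"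
      using loc K by (auto intro!: integrable_locally_integrable_mult[OF \<open>open \<Omega>\<close>, of _ K] continuous_intros)
    have "(LINT x|lebesgue_on \<Omega>. (g x \<bullet> b - g' x \<bullet> b) * \<phi> x) =
        (LINT x|lebesgue_on \<Omega>. (g x \<bullet> b) * \<phi> x) - (LINT x|lebesgue_on \<Omega>. (g' x \<bullet> b) * \<phi> x)"
      using loc \<phi> by (simp add: left_diff_distrib Bochner_Integration.integral_diff
          integrable_inner_test_function[OF \<open>open \<Omega>\<close>])
    also have "\<dots> = (LINT x|lebesgue_on \<Omega>. v x * (grad \<phi> x \<bullet> b)) - (LINT x|lebesgue_on \<Omega>. u x * (grad \<phi> x \<bullet> b))"
      using u v \<phi> b by (simp add: is_weak_gradient_def)
    also have "(LINT x|lebesgue_on \<Omega>. v x * (grad \<phi> x \<bullet> b)) = (LINT x|lebesgue_on \<Omega>. u x * (grad \<phi> x \<bullet> b))"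
      using uv ui by (intro integral_cong_AE) auto
    finally show "(LINT x|lebesgue_on \<Omega>. (g x \<bullet> b - g' x \<bullet> b) * \<phi> x) = 0" by simp
  qed
  then have "AE x in lebesgue_on \<Omega>. \<forall>b\<in>Basis. g x \<bullet> b - g' x \<bullet> b = 0"
    by (intro AE_finite_allI) auto
  then show ?thesis
    by eventually_elim (auto intro: euclidean_eqI)
qed

lemma wgrad_AE_eq:
  assumes "open \<Omega>" "is_weak_gradient \<Omega> u g"
  shows "AE x in lebesgue_on \<Omega>. wgrad \<Omega> u x = g x"
  using assms by (intro weak_gradient_unique[OF assms(1) _ assms(2)]) (auto simp: wgrad_def intro: someI[of "is_weak_gradient \<Omega> u"])

section \<open>Integration by parts against test functions\<close>

text \<open>
  The integrals of the difference quotients \<open>(F (x + t b) - F x) / t\<close> vanish by translation invariance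
  of Lebesgue measure. The mean value theorem bounds the quotients, so dominated convergence
  applies as \<open>t\<close> tends to \<open>0\<close>.
\<close>
lemma integral_derivative_compact_support:
  fixes F :: "'a::euclidean_space \<Rightarrow> real"
  assumes F: "Ck (Suc 0) F" and K: "compact K" "\<And>x. x \<notin> K \<Longrightarrow> F x = 0" and b: "b \<in> Basis"
  shows "(LINT x|lebesgue. frechet_derivative F (at x) b) = 0"
proof -
  define D where "D x = frechet_derivative F (at x) b" for x
  define t where "t n = 1 / real (Suc n)" for n
  define G where "G n x = (F (t n *\<^sub>R b + x) - F x) / t n" for n x
  have t: "t n > 0" "t n \<le> 1" for n by (auto simp: t_def)
  have "closure {x. F x \<noteq> 0} \<subseteq> K"
    by (rule closure_minimal) (use K compact_imp_closed in auto)
  then have D0: "D x = 0" if "x \<notin> K" for x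
  proof -
    have "x \<notin> closure {x. F x \<noteq> 0}" using that \<open>closure {x. F x \<noteq> 0} \<subseteq> K\<close> by blast
    then show ?thesis by (simp add: D_def frechet_derivative_outside_support)
  qed
  have Dc: "continuous_on UNIV D" and Fc: "continuous_on UNIV F"
    using F b Ck_imp_continuous_on[OF F] by (auto simp: D_def[abs_def])
  obtain M where M: "M > 0" "\<And>x. norm (D x) \<le> M"
    using compact_support_bounded[OF Dc K(1)] D0 by metis
  obtain R where R: "R > 0" "\<And>x. x \<in> K \<Longrightarrow> norm x \<le> R"
    using compact_imp_bounded[OF K(1)] bounded_pos by metis
  have deriv: "((\<lambda>s. F (s *\<^sub>R b + x)) has_real_derivative D (s *\<^sub>R b + x)) (at s)" for x s
  proof -
    have lin: "linear (frechet_derivative F (at y))" for y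
      using has_derivative_linear[OF Ck_Suc_has_derivative[OF F]] .
    have "((\<lambda>s. s *\<^sub>R b + x) has_derivative (\<lambda>h. h *\<^sub>R b)) (at s)"
      by (auto intro!: derivative_eq_intros)
    from has_derivative_compose[OF this Ck_Suc_has_derivative[OF F]]
    show ?thesis
      unfolding has_field_derivative_def D_def
      by (rule has_derivative_eq_rhs) (auto simp: linear_cmul[OF lin] mult.commute)
  qed
  \<comment> \<open>By the mean value theorem a difference quotient inherits the bound of the derivative.\<close>
  have G_eq: "\<exists>s. 0 < s \<and> s < t n \<and> G n x = D (s *\<^sub>R b + x)" for n x
    using MVT2[of 0 "t n" "\<lambda>s. F (s *\<^sub>R b + x)" "\<lambda>s. D (s *\<^sub>R b + x)"] deriv t[of n]
    by (auto simp: G_def)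
  have Gc: "continuous_on UNIV (G n)" for n
    unfolding G_def[abs_def] using t[of n]
    by (intro continuous_intros continuous_on_compose2[OF Fc]) auto
  have F_int: "integrable lborel F"
  proof -
    have "integrable lborel (\<lambda>x. indicator K x *\<^sub>R F x)"
      using K(1) Fc by (intro borel_integrable_compact) (auto intro: continuous_on_subset)
    moreover have "(\<lambda>x. indicator K x *\<^sub>R F x) = F" using K(2) by (auto simp: fun_eq_iff split: split_indicator)
    ultimately show ?thesis by simp
  qed
  have shift: "integrable lborel (\<lambda>x. F (c + x))" "(LINT x|lborel. F (c + x)) = (LINT x|lborel. F x)" for c
    using integrable_distr_eq[of "(+) c" lborel borel F] integral_distr[of "(+) c" lborel borel F]
      F_int Fc by (simp_all add: lborel_distr_plus borel_measurable_continuous_onI)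
  have "(LINT x|lborel. G n x) = 0" for n
    unfolding G_def using shift F_int by simp
  moreover have "(\<lambda>n. LINT x|lborel. G n x) \<longlonglongrightarrow> (LINT x|lborel. D x)"
  proof (rule integral_dominated_convergence[where w="\<lambda>x. M * indicator (cball 0 (R + 1)) x"])
    show "AE x in lborel. (\<lambda>n. G n x) \<longlonglongrightarrow> D x"
    proof (rule AE_I2)
      fix x
      have "filterlim t (at 0) sequentially"
        using t(1) LIMSEQ_Suc[OF lim_1_over_n[where 'a=real]]
        by (auto simp: filterlim_at t_def[abs_def] intro!: always_eventually)
      then show "(\<lambda>n. G n x) \<longlonglongrightarrow> D x"
        using deriv[of x 0] unfolding DERIV_def G_def
        by (auto dest: filterlim_compose)
    qed
    \<comment> \<open>The steps \<open>t n\<close> are at most \<open>1\<close>, so the quotients vanish at distance \<open>1\<close> from the support.\<close>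
    show "AE x in lborel. norm (G n x) \<le> M * indicator (cball 0 (R + 1)) x" for n
    proof (rule AE_I2)
      fix x
      obtain s where s: "0 < s" "s < t n" "G n x = D (s *\<^sub>R b + x)" using G_eq by blast
      show "norm (G n x) \<le> M * indicator (cball 0 (R + 1)) x"
      proof (cases "x \<in> cball 0 (R + 1)")
        case False
        then have "norm (s *\<^sub>R b + x) > R"
          using s t[of n] b norm_triangle_ineq4[of "s *\<^sub>R b + x" "s *\<^sub>R b"] by simp
        then have "D (s *\<^sub>R b + x) = 0" using D0 R(2) by force
        then show ?thesis using s M by simp
      qed (use s M in auto)
    qed
  qed (use Dc Gc emeasure_lborel_cball_finite[of 0 "R + 1"] in
      \<open>auto simp: integrable_real_indicator borel_measurable_continuous_onI\<close>)
  ultimately have "(LINT x|lborel. D x) = 0"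
    using LIMSEQ_unique[of "\<lambda>n. 0 :: real" _ 0] by auto
  then show ?thesis
    using Dc by (simp add: D_def[symmetric] integral_completion borel_measurable_continuous_onI)
qed

lemma continuous_imp_locally_integrable:
  fixes f :: "'a::euclidean_space \<Rightarrow> 'b::euclidean_space"
  assumes "continuous_on UNIV f"
  shows "locally_integrable \<Omega> f"
  unfolding locally_integrable_def
proof (intro allI impI)
  fix K assume "compact K \<and> K \<subseteq> \<Omega>"
  then have K: "compact K" by simp
  have "integrable lborel (\<lambda>x. indicator K x *\<^sub>R f x)"
    using K assms by (intro borel_integrable_compact) (auto intro: continuous_on_subset)
  then have "integrable lebesgue (\<lambda>x. indicator K x *\<^sub>R f x)"
    by (subst integrable_completion) auto
  then show "integrable (lebesgue_on K) f"
    using compact_imp_sets_lebesgue[OF K] by (simp add: integrable_restrict_space)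
qed

lemma integral_by_parts_test_function:
  fixes \<phi> \<psi> :: "'a::euclidean_space \<Rightarrow> real"
  assumes "open \<Omega>" and \<phi>: "\<And>k. Ck k \<phi>" and \<psi>: "\<psi> \<in> test_functions \<Omega>" and b: "b \<in> Basis"
  shows "(LINT x|lebesgue_on \<Omega>. \<phi> x * (grad \<psi> x \<bullet> b)) = - (LINT x|lebesgue_on \<Omega>. (grad \<phi> x \<bullet> b) * \<psi> x)"
proof -
  obtain K where K: "compact K" "K \<subseteq> \<Omega>" "\<And>x. x \<notin> K \<Longrightarrow> \<psi> x = 0" "\<And>x. x \<notin> K \<Longrightarrow> grad \<psi> x = 0"
    "continuous_on UNIV \<psi>" "continuous_on UNIV (grad \<psi>)"
    using test_functionE[OF \<psi>] by metis
  have \<psi>C: "Ck k \<psi>" for k using \<psi> by (simp add: test_functions_def)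
  note grad\<phi> = Ck_Suc_continuous_on_grad[OF \<phi>]
  have loc: "locally_integrable \<Omega> \<phi>" "locally_integrable \<Omega> (\<lambda>x. grad \<phi> x \<bullet> b)"
    by (intro continuous_imp_locally_integrable continuous_intros Ck_imp_continuous_on[OF \<phi>] grad\<phi>)+
  have int: "integrable (lebesgue_on \<Omega>) (\<lambda>x. \<phi> x * (grad \<psi> x \<bullet> b))"
      "integrable (lebesgue_on \<Omega>) (\<lambda>x. (grad \<phi> x \<bullet> b) * \<psi> x)"
    using K by (auto intro!: integrable_locally_integrable_mult[OF \<open>open \<Omega>\<close> _ K(1,2)] loc continuous_intros)
  have F: "Ck (Suc 0) (\<lambda>x. \<phi> x * \<psi> x)" by (intro Ck_mult \<phi> \<psi>C)
  have D: "frechet_derivative (\<lambda>x. \<phi> x * \<psi> x) (at x) b = \<phi> x * (grad \<psi> x \<bullet> b) + (grad \<phi> x \<bullet> b) * \<psi> x" for x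
    using fun_cong[OF frechet_derivative_at[OF has_derivative_mult[OF Ck_Suc_has_derivative[OF \<phi>]
          Ck_Suc_has_derivative[OF \<psi>C], of x]], of b]
    by (simp add: grad_inner_Basis[OF b])
  have "0 = (LINT x|lebesgue. \<phi> x * (grad \<psi> x \<bullet> b) + (grad \<phi> x \<bullet> b) * \<psi> x)"
    using integral_derivative_compact_support[OF F K(1) _ b] K(3) by (simp add: D)
  also have "\<dots> = (LINT x|lebesgue_on \<Omega>. \<phi> x * (grad \<psi> x \<bullet> b) + (grad \<phi> x \<bullet> b) * \<psi> x)"
  proof -
    have "\<psi> x = 0" "grad \<psi> x = 0" if "x \<notin> \<Omega>" for x
      using that K(2-4) by blast+
    then show ?thesis
      using open_imp_sets_lebesgue[OF \<open>open \<Omega>\<close>]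
      by (subst integral_restrict_space) (auto intro!: Bochner_Integration.integral_cong split: split_indicator)
  qed
  also have "\<dots> = (LINT x|lebesgue_on \<Omega>. \<phi> x * (grad \<psi> x \<bullet> b)) + (LINT x|lebesgue_on \<Omega>. (grad \<phi> x \<bullet> b) * \<psi> x)"
    using int by simp
  finally show ?thesis by simp
qed

section \<open>Convergence in Lebesgue spaces\<close>

text \<open>
  The larger of \<open>x\<close> and \<open>y\<close> is at least half of the sum. For questions of convergence this plays the part
  of Minkowski's inequality, with \<open>p\<close>-th powers of norms in place of the norms.
\<close>
lemma powr_add_le:
  fixes x y p :: real
  assumes "x \<ge> 0" "y \<ge> 0" "p \<ge> 0"
  shows "(x + y) powr p \<le> 2 powr p * (x powr p + y powr p)"
proof -
  have "(x + y) powr p \<le> (2 * max x y) powr p"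
    using assms by (intro powr_mono2) auto
  also have "\<dots> = 2 powr p * max x y powr p" by (rule powr_mult)
  also have "max x y powr p \<le> x powr p + y powr p" by (auto simp: max_def)
  finally show ?thesis by simp
qed

lemma powr_le_one_plus_powr:
  fixes x :: real
  assumes "x \<ge> 0" "0 \<le> q" "q \<le> p"
  shows "x powr q \<le> 1 + x powr p"
proof (cases "x \<le> 1")
  case True
  then have "x powr q \<le> 1" using assms by (simp add: powr_le1)
  then show ?thesis using powr_ge_zero[of x p] by linarith
next
  case False
  then have "x powr q \<le> x powr p" using assms by (intro powr_mono) auto
  then show ?thesis by simp
qed

text \<open>
  If \<open>x\<close> exceeds the threshold \<open>d\<close>, then \<open>x = x powr p * x powr (1 - p)\<close> and the last factor is at most
  \<open>d powr (1 - p)\<close>. On a set of finite measure this yields \<open>L\<^sup>1\<close>-convergence from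
  \<open>L\<^sup>p\<close>-convergence.
\<close>
lemma le_plus_powr:
  fixes x d p :: real
  assumes "x \<ge> 0" "d > 0" "p \<ge> 1"
  shows "x \<le> d + d powr (1 - p) * x powr p"
proof (cases "x \<le> d")
  case True
  then show ?thesis by (simp add: add_increasing2)
next
  case False
  then have "(x / d) powr 1 \<le> (x / d) powr p" using assms by (intro powr_mono) auto
  then have "x / d \<le> x powr p / d powr p" using False assms by (simp add: powr_divide)
  then have "x \<le> d * (x powr p / d powr p)" using assms by (simp add: field_simps)
  also have "\<dots> = d powr (1 - p) * x powr p" using assms by (simp add: powr_diff)
  finally show ?thesis using assms by linarith
qed

lemma Lp_space_bound:
  assumes "V \<in> Lp_space p \<Omega>" "U \<in> borel_measurable (lebesgue_on \<Omega>)" "p \<ge> 0"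
    "AE x in lebesgue_on \<Omega>. norm (U x) \<le> norm (V x)"
  shows "U \<in> Lp_space p \<Omega>"
  using assms unfolding Lp_space_def
  by (auto intro!: Bochner_Integration.integrable_bound[where f="\<lambda>x. norm (V x) powr p"]
      elim!: eventually_mono intro!: powr_mono2)

lemma Lp_space_add:
  assumes U: "U \<in> Lp_space p \<Omega>" and V: "V \<in> Lp_space p \<Omega>" and p: "p \<ge> 0"
  shows "(\<lambda>x. U x + V x) \<in> Lp_space p \<Omega>"
proof -
  have "integrable (lebesgue_on \<Omega>) (\<lambda>x. norm (U x + V x) powr p)"
  proof (rule Bochner_Integration.integrable_bound)
    show "integrable (lebesgue_on \<Omega>) (\<lambda>x. 2 powr p * (norm (U x) powr p + norm (V x) powr p))"
      using U V by (auto simp: Lp_space_def)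
    show "AE x in lebesgue_on \<Omega>. norm (norm (U x + V x) powr p)
        \<le> norm (2 powr p * (norm (U x) powr p + norm (V x) powr p))"
    proof (rule AE_I2)
      fix x
      have "norm (U x + V x) powr p \<le> (norm (U x) + norm (V x)) powr p"
        using p by (intro powr_mono2 norm_triangle_ineq) auto
      also have "\<dots> \<le> 2 powr p * (norm (U x) powr p + norm (V x) powr p)"
        using p by (intro powr_add_le) auto
      finally show "norm (norm (U x + V x) powr p)
        \<le> norm (2 powr p * (norm (U x) powr p + norm (V x) powr p))" by simp
    qed
  qed (use U V in \<open>auto simp: Lp_space_def\<close>)
  then show ?thesis using U V by (auto simp: Lp_space_def)
qed

lemma Lp_space_scaleR:
  assumes U: "U \<in> Lp_space p \<Omega>" and p: "p \<ge> 0"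
  shows "(\<lambda>x. c *\<^sub>R U x) \<in> Lp_space p \<Omega>"
  using U by (auto simp: Lp_space_def powr_mult)

lemma Lp_space_diff:
  assumes "U \<in> Lp_space p \<Omega>" "V \<in> Lp_space p \<Omega>" "p \<ge> 0"
  shows "(\<lambda>x. U x - V x) \<in> Lp_space p \<Omega>"
  using Lp_space_add[OF assms(1) Lp_space_scaleR[OF assms(2,3), of "-1"] assms(3)] by simp

lemma Lp_space_Pair_iff:
  fixes u :: "'a::euclidean_space \<Rightarrow> 'b::euclidean_space" and g :: "'a \<Rightarrow> 'c::euclidean_space"
  assumes "p \<ge> 0"
  shows "(\<lambda>x. (u x, g x)) \<in> Lp_space p \<Omega> \<longleftrightarrow> u \<in> Lp_space p \<Omega> \<and> g \<in> Lp_space p \<Omega>"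
proof
  assume L: "(\<lambda>x. (u x, g x)) \<in> Lp_space p \<Omega>"
  then have "(\<lambda>x. fst (u x, g x)) \<in> borel_measurable (lebesgue_on \<Omega>)"
      "(\<lambda>x. snd (u x, g x)) \<in> borel_measurable (lebesgue_on \<Omega>)"
    unfolding Lp_space_def mem_Collect_eq
    by (auto intro!: measurable_compose[OF _ borel_measurable_continuous_onI[of fst]]
          measurable_compose[OF _ borel_measurable_continuous_onI[of snd]]
        simp del: fst_conv snd_conv simp: continuous_on_fst continuous_on_snd)
  then show "u \<in> Lp_space p \<Omega> \<and> g \<in> Lp_space p \<Omega>"
    using Lp_space_bound[OF L _ assms, of u] Lp_space_bound[OF L _ assms, of g]
    by (auto intro: norm_fst_le norm_snd_le)
next
  assume R: "u \<in> Lp_space p \<Omega> \<and> g \<in> Lp_space p \<Omega>"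
  then have meas: "(\<lambda>x. (u x, g x)) \<in> borel_measurable (lebesgue_on \<Omega>)"
    unfolding Lp_space_def by (auto intro: borel_measurable_Pair)
  then have "(\<lambda>x. (u x, 0::'c)) \<in> borel_measurable (lebesgue_on \<Omega>)"
      "(\<lambda>x. (0::'b, g x)) \<in> borel_measurable (lebesgue_on \<Omega>)"
    using R by (auto simp: Lp_space_def intro!: borel_measurable_Pair)
  then have "(\<lambda>x. (u x, 0::'c)) \<in> Lp_space p \<Omega>" "(\<lambda>x. (0::'b, g x)) \<in> Lp_space p \<Omega>"
    using R by (auto simp: Lp_space_def norm_Pair)
  from Lp_space_add[OF this assms] show "(\<lambda>x. (u x, g x)) \<in> Lp_space p \<Omega>" by simp
qed

lemma Lp_dist_triangle:
  assumes "U \<in> Lp_space p \<Omega>" "V \<in> Lp_space p \<Omega>" "W \<in> Lp_space p \<Omega>" and p: "p \<ge> 0"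
  shows "(LINT x|lebesgue_on \<Omega>. norm (U x - W x) powr p) \<le>
    2 powr p * ((LINT x|lebesgue_on \<Omega>. norm (U x - V x) powr p) + (LINT x|lebesgue_on \<Omega>. norm (V x - W x) powr p))"
proof -
  note d = Lp_space_diff[OF assms(1,2) p] Lp_space_diff[OF assms(2,3) p] Lp_space_diff[OF assms(1,3) p]
  have "(LINT x|lebesgue_on \<Omega>. norm (U x - W x) powr p) \<le>
      (LINT x|lebesgue_on \<Omega>. 2 powr p * (norm (U x - V x) powr p + norm (V x - W x) powr p))"
  proof (rule integral_mono)
    fix x
    have "norm (U x - W x) powr p \<le> (norm (U x - V x) + norm (V x - W x)) powr p"
      using p norm_triangle_ineq[of "U x - V x" "V x - W x"] by (intro powr_mono2) auto
    also have "\<dots> \<le> 2 powr p * (norm (U x - V x) powr p + norm (V x - W x) powr p)"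
      using p by (intro powr_add_le) auto
    finally show "norm (U x - W x) powr p \<le> 2 powr p * (norm (U x - V x) powr p + norm (V x - W x) powr p)" .
  qed (use d in \<open>auto simp: Lp_space_def\<close>)
  then show ?thesis using d by (simp add: Lp_space_def)
qed

lemma finite_measure_lebesgue_on_bounded_open:
  "open \<Omega> \<Longrightarrow> bounded \<Omega> \<Longrightarrow> finite_measure (lebesgue_on \<Omega>)"
  by (simp add: finite_measure_lebesgue_on lmeasurable_open)

lemma Lp_space_mono:
  assumes \<Omega>: "finite_measure (lebesgue_on \<Omega>)" and U: "U \<in> Lp_space p \<Omega>" and "0 \<le> q" "q \<le> p"
  shows "U \<in> Lp_space q \<Omega>"
proof -
  interpret finite_measure "lebesgue_on \<Omega>" by fact
  have "integrable (lebesgue_on \<Omega>) (\<lambda>x. norm (U x) powr q)"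
  proof (rule Bochner_Integration.integrable_bound)
    show "integrable (lebesgue_on \<Omega>) (\<lambda>x. 1 + norm (U x) powr p)"
      using U by (auto simp: Lp_space_def)
    show "AE x in lebesgue_on \<Omega>. norm (norm (U x) powr q) \<le> norm (1 + norm (U x) powr p)"
      using powr_le_one_plus_powr[OF norm_ge_zero assms(3,4)] by (intro AE_I2) (simp add: add_nonneg_nonneg)
  qed (use U in \<open>auto simp: Lp_space_def\<close>)
  then show ?thesis using U by (simp add: Lp_space_def)
qed

lemma Lp_space_imp_integrable:
  assumes \<Omega>: "finite_measure (lebesgue_on \<Omega>)" and U: "U \<in> Lp_space p \<Omega>" and "1 \<le> p"
  shows "integrable (lebesgue_on \<Omega>) U"
proof -
  have "U \<in> Lp_space 1 \<Omega>" using Lp_space_mono[OF \<Omega> U _ \<open>1 \<le> p\<close>] by simp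
  then show ?thesis unfolding Lp_space_def
    using integrable_norm_iff[of U "lebesgue_on \<Omega>"] by simp
qed

lemma Lp_tendsto_imp_L1_tendsto:
  assumes \<Omega>: "finite_measure (lebesgue_on \<Omega>)" and U: "\<And>n. U n \<in> Lp_space p \<Omega>" and p: "1 \<le> p"
    and lim: "(\<lambda>n. LINT x|lebesgue_on \<Omega>. norm (U n x) powr p) \<longlonglongrightarrow> 0"
  shows "(\<lambda>n. LINT x|lebesgue_on \<Omega>. norm (U n x)) \<longlonglongrightarrow> 0"
proof (rule LIMSEQ_I)
  interpret finite_measure "lebesgue_on \<Omega>" by fact
  fix e :: real assume e: "e > 0"
  define m where "m = measure (lebesgue_on \<Omega>) \<Omega>"
  \<comment> \<open>The threshold contributes at most \<open>d m < e / 2\<close>; adding \<open>1\<close> covers \<open>m = 0\<close>.\<close>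
  define d where "d = e / (2 * (m + 1))"
  have m: "m \<ge> 0" by (simp add: m_def)
  then have d: "d > 0" using e by (simp add: d_def)
  have "d * m < e / 2" using m e by (simp add: d_def field_simps)
  have le: "(LINT x|lebesgue_on \<Omega>. norm (U n x)) \<le>
      d * m + d powr (1 - p) * (LINT x|lebesgue_on \<Omega>. norm (U n x) powr p)" for n
  proof -
    have "(LINT x|lebesgue_on \<Omega>. norm (U n x)) \<le>
        (LINT x|lebesgue_on \<Omega>. d + d powr (1 - p) * norm (U n x) powr p)"
    proof (rule integral_mono)
      show "norm (U n x) \<le> d + d powr (1 - p) * norm (U n x) powr p" for x
        using d p by (intro le_plus_powr) auto
    qed (use U[of n] Lp_space_imp_integrable[OF \<Omega> U p] in \<open>auto simp: Lp_space_def\<close>)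
    also have "\<dots> = d * m + d powr (1 - p) * (LINT x|lebesgue_on \<Omega>. norm (U n x) powr p)"
      using U[of n] by (simp add: Lp_space_def m_def mult.commute)
    finally show ?thesis .
  qed
  define X where "X n = d powr (1 - p) * (LINT x|lebesgue_on \<Omega>. norm (U n x) powr p)" for n
  have "X \<longlonglongrightarrow> 0"
    unfolding X_def using lim by (rule tendsto_mult_right_zero)
  from LIMSEQ_D[OF this, of "e / 2"] e obtain N where N: "\<And>n. n \<ge> N \<Longrightarrow> \<bar>X n\<bar> < e / 2"
    by auto
  show "\<exists>N. \<forall>n\<ge>N. norm ((LINT x|lebesgue_on \<Omega>. norm (U n x)) - 0) < e"
  proof (intro exI allI impI)
    fix n assume "n \<ge> N"
    then show "norm ((LINT x|lebesgue_on \<Omega>. norm (U n x)) - 0) < e"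
      using N[of n] le[of n] \<open>d * m < e / 2\<close> unfolding X_def by simp
  qed
qed

lemma Lp_dominated_convergence:
  fixes V :: "nat \<Rightarrow> 'a::euclidean_space \<Rightarrow> 'b::euclidean_space" and W :: "'a \<Rightarrow> 'c::euclidean_space"
  assumes W: "W \<in> Lp_space p \<Omega>" and p: "p > 0"
    and meas: "\<And>n. V n \<in> borel_measurable (lebesgue_on \<Omega>)" "V' \<in> borel_measurable (lebesgue_on \<Omega>)"
    and bound: "\<And>n. AE x in lebesgue_on \<Omega>. norm (V n x) \<le> norm (W x)"
    and lim: "AE x in lebesgue_on \<Omega>. (\<lambda>n. V n x) \<longlonglongrightarrow> V' x"
  shows "V' \<in> Lp_space p \<Omega>" "(\<lambda>n. LINT x|lebesgue_on \<Omega>. norm (V n x - V' x) powr p) \<longlonglongrightarrow> 0"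
proof -
  have bound': "AE x in lebesgue_on \<Omega>. norm (V' x) \<le> norm (W x)"
  proof -
    have "AE x in lebesgue_on \<Omega>. \<forall>n. norm (V n x) \<le> norm (W x)"
      using bound by (simp add: AE_all_countable)
    with lim show ?thesis
      by eventually_elim (auto intro: Lim_norm_ubound[OF trivial_limit_sequentially])
  qed
  then show "V' \<in> Lp_space p \<Omega>" using W meas p by (intro Lp_space_bound[OF W]) auto
  have "(\<lambda>n. LINT x|lebesgue_on \<Omega>. norm (V n x - V' x) powr p) \<longlonglongrightarrow> (LINT x|lebesgue_on \<Omega>. 0)"
  proof (rule integral_dominated_convergence)
    show "integrable (lebesgue_on \<Omega>) (\<lambda>x. 2 powr p * (norm (W x) powr p))"
      using W by (simp add: Lp_space_def)
    show "AE x in lebesgue_on \<Omega>. (\<lambda>n. norm (V n x - V' x) powr p) \<longlonglongrightarrow> 0"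
      using lim
    proof eventually_elim
      case (elim x)
      have "(\<lambda>n. norm (V n x - V' x)) \<longlonglongrightarrow> 0"
        using elim LIM_zero tendsto_norm_zero by blast
      then show ?case by (rule tendsto_zero_powrI[OF _ tendsto_const _ p]) auto
    qed
    show "AE x in lebesgue_on \<Omega>. norm (norm (V n x - V' x) powr p) \<le> 2 powr p * (norm (W x) powr p)" for n
      using bound[of n] bound'
    proof eventually_elim
      case (elim x)
      then have "norm (V n x - V' x) \<le> 2 * norm (W x)"
        using norm_triangle_ineq4[of "V n x" "V' x"] by linarith
      then have "norm (V n x - V' x) powr p \<le> (2 * norm (W x)) powr p"
        using p by (intro powr_mono2) auto
      then show ?case by (simp add: powr_mult)
    qed
  qed (use meas in auto)
  then show "(\<lambda>n. LINT x|lebesgue_on \<Omega>. norm (V n x - V' x) powr p) \<longlonglongrightarrow> 0" by simp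
qed

section \<open>Pairs approximated by test functions\<close>

text \<open>
  A function and its gradient are combined into one function with values in a product space. The
  norm of the product then measures both at once, and convergence in the Sobolev norm becomes
  convergence in one Lebesgue space.
\<close>
definition jet :: "('a::euclidean_space \<Rightarrow> real) \<Rightarrow> 'a \<Rightarrow> real \<times> 'a" where
  "jet \<phi> x = (\<phi> x, grad \<phi> x)"

text \<open>
  The closure of the jets of test functions in \<open>L\<^sup>p\<close>. Up to null sets these are the pairs of a function
  in \<open>W01p p \<Omega>\<close> and its weak gradient. The second component is kept as explicit data, so that no
  choice of a weak gradient interferes with limits.
\<close>
definition sobolev_pair :: "real \<Rightarrow> 'a::euclidean_space set \<Rightarrow> ('a \<Rightarrow> real \<times> 'a) \<Rightarrow> bool" where
  "sobolev_pair p \<Omega> U \<longleftrightarrow> U \<in> Lp_space p \<Omega> \<and>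
    (\<forall>e>0. \<exists>\<phi>\<in>test_functions \<Omega>. (LINT x|lebesgue_on \<Omega>. norm (U x - jet \<phi> x) powr p) < e)"

lemma continuous_on_jet: "\<phi> \<in> test_functions \<Omega> \<Longrightarrow> continuous_on UNIV (jet \<phi>)"
  unfolding jet_def[abs_def]
  by (erule test_functionE) (intro continuous_intros)

lemma jet_in_Lp_space:
  assumes "open \<Omega>" "bounded \<Omega>" "\<phi> \<in> test_functions \<Omega>" "p \<ge> 0"
  shows "jet \<phi> \<in> Lp_space p \<Omega>"
proof -
  interpret finite_measure "lebesgue_on \<Omega>"
    using assms by (intro finite_measure_lebesgue_on_bounded_open)
  obtain M where M: "M > 0" "\<And>x. \<bar>\<phi> x\<bar> \<le> M" "\<And>x. norm (grad \<phi> x) \<le> M"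
    using test_functionE[OF assms(3)] by metis
  have "(\<lambda>x. M + M) \<in> Lp_space p \<Omega>" by (simp add: Lp_space_def)
  moreover have "norm (jet \<phi> x) \<le> norm (M + M)" for x
    using norm_Pair_le[of "\<phi> x" "grad \<phi> x"] M(1) M(2,3)[of x] by (simp add: jet_def)
  ultimately show ?thesis
    using assms continuous_on_jet[OF assms(3)]
    by (auto intro: Lp_space_bound[OF _ continuous_imp_measurable_lebesgue_on])
qed

lemma sobolev_pair_limit:
  assumes \<Omega>: "open \<Omega>" "bounded \<Omega>" and p: "p > 0" and U: "U \<in> Lp_space p \<Omega>"
    and V: "\<And>n. sobolev_pair p \<Omega> (V n)"
    and lim: "(\<lambda>n. LINT x|lebesgue_on \<Omega>. norm (V n x - U x) powr p) \<longlonglongrightarrow> 0"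
  shows "sobolev_pair p \<Omega> U"
  unfolding sobolev_pair_def
proof (intro conjI allI impI U)
  fix e :: real assume e: "e > 0"
  define d where "d = e / 2 / 2 powr p"
  have d: "d > 0" using e by (simp add: d_def)
  from LIMSEQ_D[OF lim d] obtain n where n: "(LINT x|lebesgue_on \<Omega>. norm (V n x - U x) powr p) < d"
    by (force simp: abs_less_iff)
  obtain \<phi> where \<phi>: "\<phi> \<in> test_functions \<Omega>" "(LINT x|lebesgue_on \<Omega>. norm (V n x - jet \<phi> x) powr p) < d"
    using V[of n] d by (auto simp: sobolev_pair_def)
  have "(LINT x|lebesgue_on \<Omega>. norm (U x - jet \<phi> x) powr p) \<le>
      2 powr p * ((LINT x|lebesgue_on \<Omega>. norm (U x - V n x) powr p) + (LINT x|lebesgue_on \<Omega>. norm (V n x - jet \<phi> x) powr p))"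
    using V[of n] \<Omega> \<phi> p U by (intro Lp_dist_triangle jet_in_Lp_space) (auto simp: sobolev_pair_def)
  also have "\<dots> < 2 powr p * (d + d)"
    using n \<phi>(2) by (intro mult_strict_left_mono add_strict_mono) (auto simp: norm_minus_commute)
  also have "\<dots> = e" by (simp add: d_def)
  finally show "\<exists>\<phi>\<in>test_functions \<Omega>. (LINT x|lebesgue_on \<Omega>. norm (U x - jet \<phi> x) powr p) < e"
    using \<phi>(1) by blast
qed

lemma sobolev_pair_jet:
  assumes "open \<Omega>" "bounded \<Omega>" "p > 0" "\<phi> \<in> test_functions \<Omega>"
  shows "sobolev_pair p \<Omega> (jet \<phi>)"
  using assms jet_in_Lp_space[of \<Omega> \<phi> p] by (auto simp: sobolev_pair_def intro!: bexI[of _ \<phi>])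

lemma sobolev_pair_sequence:
  assumes "sobolev_pair p \<Omega> U"
  shows "\<exists>\<phi>. (\<forall>n. \<phi> n \<in> test_functions \<Omega>) \<and>
    (\<lambda>n. LINT x|lebesgue_on \<Omega>. norm (jet (\<phi> n) x - U x) powr p) \<longlonglongrightarrow> 0"
proof -
  have "\<exists>\<phi>\<in>test_functions \<Omega>. (LINT x|lebesgue_on \<Omega>. norm (U x - jet \<phi> x) powr p) < 1 / real (Suc n)" for n
    using assms by (simp add: sobolev_pair_def)
  then obtain \<phi> where \<phi>: "\<And>n. \<phi> n \<in> test_functions \<Omega>"
    "\<And>n. (LINT x|lebesgue_on \<Omega>. norm (U x - jet (\<phi> n) x) powr p) < 1 / real (Suc n)"
    by metis
  have "(\<lambda>n. LINT x|lebesgue_on \<Omega>. norm (U x - jet (\<phi> n) x) powr p) \<longlonglongrightarrow> 0"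
    by (rule tendsto_sandwich[OF _ _ tendsto_const LIMSEQ_Suc[OF lim_1_over_n]])
       (use \<phi>(2) in \<open>auto intro!: always_eventually less_imp_le\<close>)
  then show ?thesis using \<phi>(1) by (intro exI[of _ \<phi>]) (simp add: norm_minus_commute)
qed

lemma test_function_compose:
  fixes h :: "real \<Rightarrow> real"
  assumes h: "\<And>k. Ck k h" "\<And>t. (h has_real_derivative h' t) (at t)" "h 0 = 0"
    and \<phi>: "\<phi> \<in> test_functions \<Omega>"
  shows "(\<lambda>x. h (\<phi> x)) \<in> test_functions \<Omega>" "jet (\<lambda>x. h (\<phi> x)) x = (h (\<phi> x), h' (\<phi> x) *\<^sub>R grad \<phi> x)"
proof -
  have C: "Ck k \<phi>" for k using \<phi> by (simp add: test_functions_def)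
  have sub: "closure {x. h (\<phi> x) \<noteq> 0} \<subseteq> closure {x. \<phi> x \<noteq> 0}"
    using h(3) by (intro closure_mono) auto
  then have "compact (closure {x. h (\<phi> x) \<noteq> 0})"
    using \<phi> closed_Int_compact[of "closure {x. h (\<phi> x) \<noteq> 0}" "closure {x. \<phi> x \<noteq> 0}"]
    by (auto simp: test_functions_def inf_absorb1)
  then show "(\<lambda>x. h (\<phi> x)) \<in> test_functions \<Omega>"
    using \<phi> sub Ck_compose[OF h(1) C] by (auto simp: test_functions_def)
  have "frechet_derivative (\<lambda>x. h (\<phi> x)) (at x) = (\<lambda>b. h' (\<phi> x) * frechet_derivative \<phi> (at x) b)"
    using frechet_derivative_at[OF has_derivative_compose[OF Ck_Suc_has_derivative[OF C]
          h(2)[unfolded has_field_derivative_def]]] by metis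
  then show "jet (\<lambda>x. h (\<phi> x)) x = (h (\<phi> x), h' (\<phi> x) *\<^sub>R grad \<phi> x)"
    by (simp add: jet_def grad_def scaleR_sum_right)
qed

lemma Lp_space_pairD:
  assumes "U \<in> Lp_space p \<Omega>" "p \<ge> 0"
  shows "(\<lambda>x. fst (U x)) \<in> Lp_space p \<Omega>" "(\<lambda>x. snd (U x)) \<in> Lp_space p \<Omega>"
  using assms Lp_space_Pair_iff[of p "\<lambda>x. fst (U x)" "\<lambda>x. snd (U x)"] by auto

lemma abs_diff_le_of_derivative_bound:
  fixes h :: "real \<Rightarrow> real"
  assumes "\<And>t. (h has_real_derivative h' t) (at t)" "\<And>t. \<bar>h' t\<bar> \<le> M"
  shows "\<bar>h s - h t\<bar> \<le> M * \<bar>s - t\<bar>"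
  using field_differentiable_bound[of UNIV h h' M s t] assms by simp

text \<open>
  Let the jets of \<open>\<phi> n\<close> converge to \<open>U = (u, g)\<close>. Then \<open>h \<circ> \<phi> n\<close> is again a test function, and its jet
  differs from the pair in the conclusion by at most
  \<open>2 M \<bar>jet (\<phi> n) - U\<bar> + \<bar>h' (\<phi> n) - h' (u)\<bar> \<bar>g\<bar>\<close>. The second term tends to \<open>0\<close> in \<open>L\<^sup>p\<close> by
  dominated convergence along a subsequence that converges almost everywhere.
\<close>
lemma sobolev_pair_smooth_compose:
  assumes \<Omega>: "open \<Omega>" "bounded \<Omega>" and p: "p > 0" and U: "sobolev_pair p \<Omega> U"
    and h: "\<And>k. Ck k h" "\<And>t. (h has_real_derivative h' t) (at t)" "h 0 = 0" "\<And>t. \<bar>h' t\<bar> \<le> M"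
    and h': "continuous_on UNIV h'"
  shows "sobolev_pair p \<Omega> (\<lambda>x. (h (fst (U x)), h' (fst (U x)) *\<^sub>R snd (U x)))"
proof -
  define V where "V x = (h (fst (U x)), h' (fst (U x)) *\<^sub>R snd (U x))" for x
  have M: "M \<ge> 0" using h(4)[of 0] by linarith
  note lip = abs_diff_le_of_derivative_bound[OF h(2,4)]
  have hc: "continuous_on UNIV h" using Ck_imp_continuous_on[OF h(1)] .
  have UL: "U \<in> Lp_space p \<Omega>" using U by (simp add: sobolev_pair_def)
  note uL = Lp_space_pairD(1)[OF UL less_imp_le[OF p]] and gL = Lp_space_pairD(2)[OF UL less_imp_le[OF p]]
  have um: "(\<lambda>x. fst (U x)) \<in> borel_measurable (lebesgue_on \<Omega>)" "(\<lambda>x. snd (U x)) \<in> borel_measurable (lebesgue_on \<Omega>)"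
    using uL gL by (auto simp: Lp_space_def)
  have comp: "(\<lambda>x. h (w x)) \<in> borel_measurable (lebesgue_on \<Omega>)" "(\<lambda>x. h' (w x)) \<in> borel_measurable (lebesgue_on \<Omega>)"
    if "w \<in> borel_measurable (lebesgue_on \<Omega>)" for w
    using that by (auto intro!: borel_measurable_continuous_on[OF hc] borel_measurable_continuous_on[OF h'])
  have VL: "V \<in> Lp_space p \<Omega>"
    unfolding V_def Lp_space_Pair_iff[OF less_imp_le[OF p]]
  proof
    show "(\<lambda>x. h (fst (U x))) \<in> Lp_space p \<Omega>"
      using lip[of _ 0] h(3) M comp um p
      by (intro Lp_space_bound[OF Lp_space_scaleR[OF uL less_imp_le[OF p], of M]]) (auto simp: abs_mult)
    show "(\<lambda>x. h' (fst (U x)) *\<^sub>R snd (U x)) \<in> Lp_space p \<Omega>"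
      using h(4) M comp um p
      by (intro Lp_space_bound[OF Lp_space_scaleR[OF gL less_imp_le[OF p], of M]]) (auto intro!: mult_right_mono)
  qed
  obtain \<phi> where \<phi>: "\<And>n. \<phi> n \<in> test_functions \<Omega>"
    "(\<lambda>n. LINT x|lebesgue_on \<Omega>. norm (jet (\<phi> n) x - U x) powr p) \<longlonglongrightarrow> 0"
    using sobolev_pair_sequence[OF U] by blast
  have diffL: "(\<lambda>x. jet (\<phi> n) x - U x) \<in> Lp_space p \<Omega>" for n
    using jet_in_Lp_space[OF \<Omega> \<phi>(1)] UL p by (intro Lp_space_diff) auto
  have "\<exists>r. strict_mono r \<and> (AE x in lebesgue_on \<Omega>. (\<lambda>n. norm (jet (\<phi> (r n)) x - U x) powr p) \<longlonglongrightarrow> 0)"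
    using diffL \<phi>(2) by (intro tendsto_L1_AE_subseq[where u="\<lambda>n x. norm (jet (\<phi> n) x - U x) powr p"])
      (auto simp: Lp_space_def)
  then obtain r where r: "strict_mono r"
    and rAE: "AE x in lebesgue_on \<Omega>. (\<lambda>n. norm (jet (\<phi> (r n)) x - U x) powr p) \<longlonglongrightarrow> 0" by blast
  have "AE x in lebesgue_on \<Omega>. (\<lambda>n. \<phi> (r n) x) \<longlonglongrightarrow> fst (U x)"
    using rAE
  proof eventually_elim
    case (elim x)
    have "(\<lambda>n. (norm (jet (\<phi> (r n)) x - U x) powr p) powr (1 / p)) \<longlonglongrightarrow> 0"
      by (rule tendsto_zero_powrI[OF elim tendsto_const]) (use p in auto)
    then have "(\<lambda>n. norm (jet (\<phi> (r n)) x - U x)) \<longlonglongrightarrow> 0" using p by (simp add: powr_powr)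
    then have "(\<lambda>n. jet (\<phi> (r n)) x) \<longlonglongrightarrow> U x"
      using LIM_zero_iff tendsto_norm_zero_iff by blast
    from tendsto_fst[OF this] show ?case by (simp add: jet_def)
  qed
  then have conv: "AE x in lebesgue_on \<Omega>. (\<lambda>n. h' (\<phi> (r n) x) *\<^sub>R snd (U x)) \<longlonglongrightarrow> h' (fst (U x)) *\<^sub>R snd (U x)"
    by eventually_elim (auto intro!: tendsto_intros continuous_on_tendsto_compose[OF h'])
  have \<phi>m: "\<phi> n \<in> borel_measurable (lebesgue_on \<Omega>)" for n
    using test_functionE[OF \<phi>(1)] by (metis continuous_imp_measurable_lebesgue_on)
  define W where "W n x = h' (\<phi> (r n) x) *\<^sub>R snd (U x)" for n x
  define W' where "W' x = h' (fst (U x)) *\<^sub>R snd (U x)" for x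
  have Wm: "W n \<in> borel_measurable (lebesgue_on \<Omega>)" for n
    unfolding W_def using comp \<phi>m um by (intro borel_measurable_scaleR) auto
  have W'm: "W' \<in> borel_measurable (lebesgue_on \<Omega>)"
    unfolding W'_def using comp um by (intro borel_measurable_scaleR) auto
  have "norm (W n x) \<le> norm (M *\<^sub>R snd (U x))" for n x
    unfolding W_def using h(4) M by (auto intro!: mult_right_mono)
  note W_conv = Lp_dominated_convergence[OF Lp_space_scaleR[OF gL less_imp_le[OF p], of M] p Wm W'm AE_I2[OF this] conv[folded W_def W'_def]]
  have WL: "W n \<in> Lp_space p \<Omega>" for n
    using \<open>\<And>n x. norm (W n x) \<le> norm (M *\<^sub>R snd (U x))\<close> Wm p
    by (intro Lp_space_bound[OF Lp_space_scaleR[OF gL less_imp_le[OF p], of M]]) auto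
  note hjet = test_function_compose[OF h(1-3) \<phi>(1)]
  have "(\<lambda>n. LINT x|lebesgue_on \<Omega>. norm (jet (\<lambda>x. h (\<phi> (r n) x)) x - V x) powr p) \<longlonglongrightarrow> 0"
  proof (rule tendsto_sandwich[OF _ _ tendsto_const])
    let ?b = "\<lambda>n. 2 powr p * ((2 * M) powr p * (LINT x|lebesgue_on \<Omega>. norm (jet (\<phi> (r n)) x - U x) powr p)
         + (LINT x|lebesgue_on \<Omega>. norm (W n x - W' x) powr p))"
    have "(\<lambda>n. LINT x|lebesgue_on \<Omega>. norm (jet (\<phi> (r n)) x - U x) powr p) \<longlonglongrightarrow> 0"
      using LIMSEQ_subseq_LIMSEQ[OF \<phi>(2) r] by (simp add: o_def)
    then show "?b \<longlonglongrightarrow> 0"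
      using W_conv(2) by (auto intro!: tendsto_eq_intros)
    have "(LINT x|lebesgue_on \<Omega>. norm (jet (\<lambda>x. h (\<phi> (r n) x)) x - V x) powr p) \<le> ?b n" for n
    proof -
      have "(LINT x|lebesgue_on \<Omega>. norm (jet (\<lambda>x. h (\<phi> (r n) x)) x - V x) powr p) \<le>
        (LINT x|lebesgue_on \<Omega>. 2 powr p * ((2 * M) powr p * norm (jet (\<phi> (r n)) x - U x) powr p + norm (W n x - W' x) powr p))"
      proof (rule integral_mono)
        show "integrable (lebesgue_on \<Omega>) (\<lambda>x. norm (jet (\<lambda>x. h (\<phi> (r n) x)) x - V x) powr p)"
          using Lp_space_diff[OF jet_in_Lp_space[OF \<Omega> hjet(1)] VL] p by (simp add: Lp_space_def)
        show "integrable (lebesgue_on \<Omega>)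
            (\<lambda>x. 2 powr p * ((2 * M) powr p * norm (jet (\<phi> (r n)) x - U x) powr p + norm (W n x - W' x) powr p))"
          using diffL Lp_space_diff[OF WL W_conv(1)] p by (simp add: Lp_space_def)
        fix x
        let ?d = "norm (jet (\<phi> (r n)) x - U x)"
        have d: "\<bar>\<phi> (r n) x - fst (U x)\<bar> \<le> ?d" "norm (grad (\<phi> (r n)) x - snd (U x)) \<le> ?d"
          using norm_fst_le[of "\<phi> (r n) x - fst (U x)" "grad (\<phi> (r n)) x - snd (U x)"]
            norm_snd_le[of "grad (\<phi> (r n)) x - snd (U x)" "\<phi> (r n) x - fst (U x)"]
          by (simp_all add: jet_def minus_prod_def)
        have "norm (jet (\<lambda>x. h (\<phi> (r n) x)) x - V x) =
            norm (h (\<phi> (r n) x) - h (fst (U x)), h' (\<phi> (r n) x) *\<^sub>R (grad (\<phi> (r n)) x - snd (U x)) + (W n x - W' x))"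
          by (simp add: hjet(2) V_def W_def W'_def scaleR_diff_right)
        also have "\<dots> \<le> \<bar>h (\<phi> (r n) x) - h (fst (U x))\<bar> +
            norm (h' (\<phi> (r n) x) *\<^sub>R (grad (\<phi> (r n)) x - snd (U x)) + (W n x - W' x))"
          by (rule order_trans[OF norm_Pair_le]) simp
        also have "\<dots> \<le> M * \<bar>\<phi> (r n) x - fst (U x)\<bar> +
            (\<bar>h' (\<phi> (r n) x)\<bar> * norm (grad (\<phi> (r n)) x - snd (U x)) + norm (W n x - W' x))"
          by (intro add_mono lip order_trans[OF norm_triangle_ineq]) simp_all
        also have "\<dots> \<le> M * ?d + (M * ?d + norm (W n x - W' x))"
          using d h(4) M by (intro add_mono mult_mono) auto
        finally have "norm (jet (\<lambda>x. h (\<phi> (r n) x)) x - V x) \<le> (2 * M) * ?d + norm (W n x - W' x)" by simp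
        then have "norm (jet (\<lambda>x. h (\<phi> (r n) x)) x - V x) powr p \<le> ((2 * M) * ?d + norm (W n x - W' x)) powr p"
          using p by (intro powr_mono2) auto
        also have "\<dots> \<le> 2 powr p * (((2 * M) * ?d) powr p + norm (W n x - W' x) powr p)"
          using p M by (intro powr_add_le) auto
        also have "((2 * M) * ?d) powr p = (2 * M) powr p * ?d powr p" by (rule powr_mult)
        finally show "norm (jet (\<lambda>x. h (\<phi> (r n) x)) x - V x) powr p \<le>
            2 powr p * ((2 * M) powr p * ?d powr p + norm (W n x - W' x) powr p)" .
      qed
      also have "\<dots> = ?b n"
        using diffL Lp_space_diff[OF WL W_conv(1)] p by (simp add: Lp_space_def)
      finally show ?thesis .
    qed
    then show "\<forall>\<^sub>F n in sequentially. (LINT x|lebesgue_on \<Omega>. norm (jet (\<lambda>x. h (\<phi> (r n) x)) x - V x) powr p) \<le> ?b n"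
      by simp
  qed simp
  then have "sobolev_pair p \<Omega> V"
    using sobolev_pair_jet[OF \<Omega> p hjet(1)] by (intro sobolev_pair_limit[OF \<Omega> p VL])
  then show ?thesis unfolding V_def .
qed

text \<open>
  The chain rule for functions that are not smooth, such as the positive part: only pointwise
  convergence of \<open>h n\<close> and \<open>h' n\<close> is required, since \<open>2 M \<bar>U\<bar>\<close> dominates all the pairs involved. The
  limit \<open>k\<close> may differ from the derivative of \<open>h0\<close> at exceptional points.
\<close>
lemma sobolev_pair_limit_compose:
  assumes \<Omega>: "open \<Omega>" "bounded \<Omega>" and p: "p > 0" and U: "sobolev_pair p \<Omega> U"
    and h: "\<And>n k. Ck k (h n)" "\<And>n t. (h n has_real_derivative h' n t) (at t)" "\<And>n. h n 0 = 0"
      "\<And>n t. \<bar>h' n t\<bar> \<le> M" "\<And>n. continuous_on UNIV (h' n)"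
    and lim: "\<And>t. (\<lambda>n. h n t) \<longlonglongrightarrow> h0 t" "\<And>t. (\<lambda>n. h' n t) \<longlonglongrightarrow> k t"
  shows "sobolev_pair p \<Omega> (\<lambda>x. (h0 (fst (U x)), k (fst (U x)) *\<^sub>R snd (U x)))"
proof -
  define V where "V n x = (h n (fst (U x)), h' n (fst (U x)) *\<^sub>R snd (U x))" for n x
  define V' where "V' x = (h0 (fst (U x)), k (fst (U x)) *\<^sub>R snd (U x))" for x
  have M: "M \<ge> 0" using h(4)[of 0 0] by linarith
  have UL: "U \<in> Lp_space p \<Omega>" using U by (simp add: sobolev_pair_def)
  have V: "sobolev_pair p \<Omega> (V n)" for n
    unfolding V_def by (rule sobolev_pair_smooth_compose[OF \<Omega> p U h])
  then have Vm: "V n \<in> borel_measurable (lebesgue_on \<Omega>)" for n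
    by (simp add: sobolev_pair_def Lp_space_def)
  have lim': "(\<lambda>n. V n x) \<longlonglongrightarrow> V' x" for x
    unfolding V_def V'_def by (intro tendsto_intros lim)
  have V'm: "V' \<in> borel_measurable (lebesgue_on \<Omega>)"
    using lim' by (intro borel_measurable_LIMSEQ_metric[OF Vm])
  have bd: "norm (V n x) \<le> norm ((2 * M) *\<^sub>R U x)" for n x
  proof -
    have "norm (V n x) \<le> \<bar>h n (fst (U x))\<bar> + \<bar>h' n (fst (U x))\<bar> * norm (snd (U x))"
      unfolding V_def by (rule order_trans[OF norm_Pair_le]) simp
    also have "\<dots> \<le> M * \<bar>fst (U x)\<bar> + M * norm (snd (U x))"
      using abs_diff_le_of_derivative_bound[OF h(2,4), of n "fst (U x)" 0] h(3,4)
      by (intro add_mono mult_right_mono) auto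
    also have "\<dots> \<le> M * norm (U x) + M * norm (U x)"
      using M norm_fst_le[of "fst (U x)" "snd (U x)"] norm_snd_le[of "snd (U x)" "fst (U x)"]
      by (intro add_mono mult_left_mono) auto
    finally show ?thesis using M by simp
  qed
  note conv = Lp_dominated_convergence[OF Lp_space_scaleR[OF UL less_imp_le[OF p], of "2 * M"] p Vm V'm AE_I2[OF bd] AE_I2[OF lim']]
  have "sobolev_pair p \<Omega> V'"
    by (rule sobolev_pair_limit[OF \<Omega> p conv(1) V conv(2)])
  then show ?thesis unfolding V'_def .
qed

section \<open>Sobolev functions with zero boundary values\<close>

lemma integrable_imp_locally_integrable:
  fixes u :: "'a::euclidean_space \<Rightarrow> 'b::euclidean_space"
  assumes "\<Omega> \<in> sets lebesgue" "integrable (lebesgue_on \<Omega>) u"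
  shows "locally_integrable \<Omega> u"
  unfolding locally_integrable_def
proof (intro allI impI)
  fix K assume K: "compact K \<and> K \<subseteq> \<Omega>"
  then have Ks: "K \<in> sets lebesgue" by (simp add: compact_imp_sets_lebesgue)
  have "integrable lebesgue (\<lambda>x. indicator \<Omega> x *\<^sub>R u x)"
    using assms by (simp add: integrable_restrict_space)
  then have "integrable lebesgue (\<lambda>x. indicator K x *\<^sub>R (indicator \<Omega> x *\<^sub>R u x))"
    by (rule integrable_mult_indicator[OF Ks])
  moreover have "(\<lambda>x. indicator K x *\<^sub>R (indicator \<Omega> x *\<^sub>R u x)) = (\<lambda>x. indicator K x *\<^sub>R u x)"
    using K by (auto simp: fun_eq_iff split: split_indicator)
  ultimately show "integrable (lebesgue_on K) u"
    using Ks by (simp add: integrable_restrict_space)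
qed

text \<open>
  For test functions \<open>\<phi>\<close> the defining identity is integration by parts, and for fixed \<open>\<psi>\<close> both sides
  depend continuously on the pair in \<open>L\<^sup>1\<close>.
\<close>
lemma sobolev_pair_imp_weak_gradient:
  fixes u :: "'a::euclidean_space \<Rightarrow> real"
  assumes \<Omega>: "open \<Omega>" "bounded \<Omega>" and p: "p \<ge> 1" and U: "sobolev_pair p \<Omega> (\<lambda>x. (u x, g x))"
  shows "is_weak_gradient \<Omega> u g"
  unfolding is_weak_gradient_def
proof (intro conjI ballI)
  note fin = finite_measure_lebesgue_on_bounded_open[OF \<Omega>]
  have UL: "(\<lambda>x. (u x, g x)) \<in> Lp_space p \<Omega>" using U by (simp add: sobolev_pair_def)
  have int: "integrable (lebesgue_on \<Omega>) u" "integrable (lebesgue_on \<Omega>) g"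
    using Lp_space_pairD[OF UL] Lp_space_imp_integrable[OF fin _ p] p by auto
  then show loc: "locally_integrable \<Omega> u" "locally_integrable \<Omega> g"
    using open_imp_sets_lebesgue[OF \<Omega>(1)] by (auto intro: integrable_imp_locally_integrable)
  fix \<psi> b assume \<psi>: "\<psi> \<in> test_functions \<Omega>" and b: "b \<in> (Basis :: 'a set)"
  obtain K M where K: "compact K" "K \<subseteq> \<Omega>" "\<And>x. x \<notin> K \<Longrightarrow> \<psi> x = 0" "\<And>x. x \<notin> K \<Longrightarrow> grad \<psi> x = 0"
    "M > 0" "\<And>x. \<bar>\<psi> x\<bar> \<le> M" "\<And>x. norm (grad \<psi> x) \<le> M"
    "continuous_on UNIV \<psi>" "continuous_on UNIV (grad \<psi>)"
    by (rule test_functionE[OF \<psi>]) (rule that; assumption)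
  obtain \<phi> where \<phi>: "\<And>n. \<phi> n \<in> test_functions \<Omega>"
    "(\<lambda>n. LINT x|lebesgue_on \<Omega>. norm (jet (\<phi> n) x - (u x, g x)) powr p) \<longlonglongrightarrow> 0"
    using sobolev_pair_sequence[OF U] by blast
  have diffL: "(\<lambda>x. jet (\<phi> n) x - (u x, g x)) \<in> Lp_space p \<Omega>" for n
    using jet_in_Lp_space[OF \<Omega> \<phi>(1)] UL p by (intro Lp_space_diff) auto
  have L1: "(\<lambda>n. LINT x|lebesgue_on \<Omega>. norm (jet (\<phi> n) x - (u x, g x))) \<longlonglongrightarrow> 0"
    by (rule Lp_tendsto_imp_L1_tendsto[OF fin diffL p \<phi>(2)])
  have intv: "integrable (lebesgue_on \<Omega>) (\<lambda>x. v x * (grad \<psi> x \<bullet> b))"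
      "integrable (lebesgue_on \<Omega>) (\<lambda>x. v x * \<psi> x)"
    if "locally_integrable \<Omega> v" for v :: "'a \<Rightarrow> real"
    using that K by (auto intro!: integrable_locally_integrable_mult[OF \<Omega>(1) _ K(1,2)] continuous_intros)
  note loc' = loc(1) locally_integrable_inner[OF loc(2), of b]
  let ?T = "(LINT x|lebesgue_on \<Omega>. u x * (grad \<psi> x \<bullet> b)) + (LINT x|lebesgue_on \<Omega>. (g x \<bullet> b) * \<psi> x)"
  have "\<bar>?T\<bar> \<le> 2 * M * (LINT x|lebesgue_on \<Omega>. norm (jet (\<phi> n) x - (u x, g x)))" for n
  proof -
    have c: "continuous_on UNIV (\<phi> n)" "continuous_on UNIV (grad (\<phi> n))"
      using test_functionE[OF \<phi>(1)[of n]] by blast+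
    have loc\<phi>: "locally_integrable \<Omega> (\<phi> n)" "locally_integrable \<Omega> (\<lambda>x. grad (\<phi> n) x \<bullet> b)"
      using c by (auto intro!: continuous_imp_locally_integrable continuous_intros)
    have "(LINT x|lebesgue_on \<Omega>. \<phi> n x * (grad \<psi> x \<bullet> b)) + (LINT x|lebesgue_on \<Omega>. (grad (\<phi> n) x \<bullet> b) * \<psi> x) = 0"
      using integral_by_parts_test_function[OF \<Omega>(1) _ \<psi> b, of "\<phi> n"] \<phi>(1)[of n]
      by (simp add: test_functions_def)
    then have "?T = (LINT x|lebesgue_on \<Omega>. u x * (grad \<psi> x \<bullet> b) + (g x \<bullet> b) * \<psi> x
        - (\<phi> n x * (grad \<psi> x \<bullet> b) + (grad (\<phi> n) x \<bullet> b) * \<psi> x))"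
      using intv(1)[OF loc'(1)] intv(2)[OF loc'(2)] intv(1)[OF loc\<phi>(1)] intv(2)[OF loc\<phi>(2)]
      by simp
    then have "\<bar>?T\<bar> = \<bar>LINT x|lebesgue_on \<Omega>. u x * (grad \<psi> x \<bullet> b) + (g x \<bullet> b) * \<psi> x
        - (\<phi> n x * (grad \<psi> x \<bullet> b) + (grad (\<phi> n) x \<bullet> b) * \<psi> x)\<bar>"
      by (rule arg_cong)
    also have "\<dots> \<le> (LINT x|lebesgue_on \<Omega>. \<bar>u x * (grad \<psi> x \<bullet> b) + (g x \<bullet> b) * \<psi> x
        - (\<phi> n x * (grad \<psi> x \<bullet> b) + (grad (\<phi> n) x \<bullet> b) * \<psi> x)\<bar>)"
      by (rule integral_abs_bound)
    also have "\<dots> \<le> (LINT x|lebesgue_on \<Omega>. 2 * M * norm (jet (\<phi> n) x - (u x, g x)))"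
    proof (rule integral_mono)
      show "integrable (lebesgue_on \<Omega>) (\<lambda>x. \<bar>u x * (grad \<psi> x \<bullet> b) + (g x \<bullet> b) * \<psi> x
        - (\<phi> n x * (grad \<psi> x \<bullet> b) + (grad (\<phi> n) x \<bullet> b) * \<psi> x)\<bar>)"
        by (intro integrable_abs Bochner_Integration.integrable_diff Bochner_Integration.integrable_add
            intv loc' loc\<phi>)
      show "integrable (lebesgue_on \<Omega>) (\<lambda>x. 2 * M * norm (jet (\<phi> n) x - (u x, g x)))"
        by (intro integrable_mult_right integrable_norm Lp_space_imp_integrable[OF fin diffL p])
      fix x
      let ?d = "norm (jet (\<phi> n) x - (u x, g x))"
      have d: "\<bar>\<phi> n x - u x\<bar> \<le> ?d" "norm (grad (\<phi> n) x - g x) \<le> ?d"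
        using norm_fst_le[of "\<phi> n x - u x" "grad (\<phi> n) x - g x"]
          norm_snd_le[of "grad (\<phi> n) x - g x" "\<phi> n x - u x"]
        by (simp_all add: jet_def)
      have "\<bar>u x * (grad \<psi> x \<bullet> b) + (g x \<bullet> b) * \<psi> x - (\<phi> n x * (grad \<psi> x \<bullet> b) + (grad (\<phi> n) x \<bullet> b) * \<psi> x)\<bar>
        = \<bar>(\<phi> n x - u x) * (grad \<psi> x \<bullet> b) + ((grad (\<phi> n) x - g x) \<bullet> b) * \<psi> x\<bar>"
        by (simp add: algebra_simps inner_diff_left)
      also have "\<dots> \<le> \<bar>\<phi> n x - u x\<bar> * \<bar>grad \<psi> x \<bullet> b\<bar> + \<bar>(grad (\<phi> n) x - g x) \<bullet> b\<bar> * \<bar>\<psi> x\<bar>"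
        by (rule order_trans[OF abs_triangle_ineq]) (simp add: abs_mult)
      also have "\<dots> \<le> ?d * M + ?d * M"
        using d K(6,7)[of x] order_trans[OF Basis_le_norm[OF b] K(7)[of x]]
          order_trans[OF Basis_le_norm[OF b] d(2)]
        by (intro add_mono mult_mono) auto
      finally show "\<bar>u x * (grad \<psi> x \<bullet> b) + (g x \<bullet> b) * \<psi> x
          - (\<phi> n x * (grad \<psi> x \<bullet> b) + (grad (\<phi> n) x \<bullet> b) * \<psi> x)\<bar> \<le> 2 * M * ?d" by simp
    qed
    finally show ?thesis by simp
  qed
  moreover have "(\<lambda>n. 2 * M * (LINT x|lebesgue_on \<Omega>. norm (jet (\<phi> n) x - (u x, g x)))) \<longlonglongrightarrow> 0"
    using L1 by (rule tendsto_mult_right_zero)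
  ultimately have "\<bar>?T\<bar> \<le> 0"
    by (intro LIMSEQ_le_const) auto
  then show "(LINT x|lebesgue_on \<Omega>. u x * (grad \<psi> x \<bullet> b)) = - (LINT x|lebesgue_on \<Omega>. (g x \<bullet> b) * \<psi> x)"
    by simp
qed

lemma borel_measurable_lebesgue_on_AE:
  fixes f g :: "'a::euclidean_space \<Rightarrow> 'b::euclidean_space"
  assumes S: "S \<in> sets lebesgue" and f: "f \<in> borel_measurable (lebesgue_on S)"
    and ae: "AE x in lebesgue_on S. f x = g x"
  shows "g \<in> borel_measurable (lebesgue_on S)"
proof -
  have "AE x in lebesgue. x \<in> S \<longrightarrow> f x = g x"
    using ae S by (subst (asm) AE_restrict_space_iff) auto
  then have "AE x in lebesgue. indicator S x *\<^sub>R f x = indicator S x *\<^sub>R g x"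
    by eventually_elim (auto split: split_indicator)
  from borel_measurable_AE[OF _ this] show ?thesis
    using f S by (simp add: borel_measurable_restrict_space_iff)
qed

lemma Lp_space_AE_cong:
  assumes "S \<in> sets lebesgue" and f: "f \<in> Lp_space p S" and ae: "AE x in lebesgue_on S. f x = g x"
  shows "g \<in> Lp_space p S"
proof -
  have g: "g \<in> borel_measurable (lebesgue_on S)"
    using borel_measurable_lebesgue_on_AE[OF assms(1) _ ae] f by (simp add: Lp_space_def)
  have "integrable (lebesgue_on S) (\<lambda>x. norm (g x) powr p)"
    by (rule integrable_cong_AE_imp[where g="\<lambda>x. norm (f x) powr p"]) (use f g ae in \<open>auto simp: Lp_space_def\<close>)
  with g show ?thesis by (simp add: Lp_space_def)
qed

lemma Lp_norm_powr:
  assumes "p > 0"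
  shows "Lp_norm p \<Omega> u powr p = (LINT x|lebesgue_on \<Omega>. norm (u x) powr p)"
proof -
  have "(LINT x|lebesgue_on \<Omega>. norm (u x) powr p) \<ge> 0" by (rule Bochner_Integration.integral_nonneg) simp
  then show ?thesis using assms by (simp add: Lp_norm_def powr_powr)
qed

lemma Lp_norm_tendsto_0_iff:
  assumes "p > 0"
  shows "(\<lambda>n. Lp_norm p \<Omega> (F n)) \<longlonglongrightarrow> 0 \<longleftrightarrow> (\<lambda>n. LINT x|lebesgue_on \<Omega>. norm (F n x) powr p) \<longlonglongrightarrow> 0"
proof
  assume "(\<lambda>n. Lp_norm p \<Omega> (F n)) \<longlonglongrightarrow> 0"
  then have "(\<lambda>n. Lp_norm p \<Omega> (F n) powr p) \<longlonglongrightarrow> 0"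
    by (rule tendsto_zero_powrI[OF _ tendsto_const _ assms]) (simp add: Lp_norm_def)
  then show "(\<lambda>n. LINT x|lebesgue_on \<Omega>. norm (F n x) powr p) \<longlonglongrightarrow> 0"
    by (simp add: Lp_norm_powr[OF assms])
next
  assume "(\<lambda>n. LINT x|lebesgue_on \<Omega>. norm (F n x) powr p) \<longlonglongrightarrow> 0"
  then show "(\<lambda>n. Lp_norm p \<Omega> (F n)) \<longlonglongrightarrow> 0"
    unfolding Lp_norm_def
    by (rule tendsto_zero_powrI[OF _ tendsto_const]) (use assms in \<open>auto intro!: Bochner_Integration.integral_nonneg\<close>)
qed

text \<open>
  The chosen representative \<open>wgrad \<Omega> u\<close> agrees with \<open>g\<close> only almost everywhere. It is measurable and
  \<open>p\<close>-integrable because Lebesgue measure is complete.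
\<close>
lemma sobolev_pair_imp_W01p:
  fixes u :: "'a::euclidean_space \<Rightarrow> real"
  assumes \<Omega>: "open \<Omega>" "bounded \<Omega>" and p: "p \<ge> 1" and U: "sobolev_pair p \<Omega> (\<lambda>x. (u x, g x))"
  shows "u \<in> W01p p \<Omega>" "AE x in lebesgue_on \<Omega>. wgrad \<Omega> u x = g x"
proof -
  have wg: "is_weak_gradient \<Omega> u g" by (rule sobolev_pair_imp_weak_gradient[OF assms])
  show ae: "AE x in lebesgue_on \<Omega>. wgrad \<Omega> u x = g x" by (rule wgrad_AE_eq[OF \<Omega>(1) wg])
  have UL: "(\<lambda>x. (u x, g x)) \<in> Lp_space p \<Omega>" using U by (simp add: sobolev_pair_def)
  have L: "u \<in> Lp_space p \<Omega>" "g \<in> Lp_space p \<Omega>"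
    using Lp_space_pairD[OF UL] p by auto
  have ae': "AE x in lebesgue_on \<Omega>. g x = wgrad \<Omega> u x" using ae by eventually_elim simp
  have gL: "wgrad \<Omega> u \<in> Lp_space p \<Omega>"
    by (rule Lp_space_AE_cong[OF open_imp_sets_lebesgue[OF \<Omega>(1)] L(2) ae'])
  obtain \<phi> where \<phi>: "\<And>n. \<phi> n \<in> test_functions \<Omega>"
    "(\<lambda>n. LINT x|lebesgue_on \<Omega>. norm (jet (\<phi> n) x - (u x, g x)) powr p) \<longlonglongrightarrow> 0"
    using sobolev_pair_sequence[OF U] by blast
  have jL: "jet (\<phi> n) \<in> Lp_space p \<Omega>" for n
    using jet_in_Lp_space[OF \<Omega> \<phi>(1)] p by simp
  have diffL: "(\<lambda>x. jet (\<phi> n) x - (u x, g x)) \<in> Lp_space p \<Omega>" for n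
    using jL UL p by (intro Lp_space_diff) auto
  have \<phi>L: "\<phi> n \<in> Lp_space p \<Omega>" "grad (\<phi> n) \<in> Lp_space p \<Omega>" for n
    using Lp_space_pairD[OF jL[of n]] p by (auto simp: jet_def)
  have "(\<lambda>n. LINT x|lebesgue_on \<Omega>. norm (u x - \<phi> n x) powr p) \<longlonglongrightarrow> 0"
  proof (rule tendsto_sandwich[OF _ _ tendsto_const \<phi>(2)])
    show "\<forall>\<^sub>F n in sequentially. (LINT x|lebesgue_on \<Omega>. norm (u x - \<phi> n x) powr p)
        \<le> (LINT x|lebesgue_on \<Omega>. norm (jet (\<phi> n) x - (u x, g x)) powr p)"
    proof (rule always_eventually, rule allI, rule integral_mono)
      fix n x
      show "norm (u x - \<phi> n x) powr p \<le> norm (jet (\<phi> n) x - (u x, g x)) powr p"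
        using p norm_fst_le[of "\<phi> n x - u x" "grad (\<phi> n) x - g x"]
        by (intro powr_mono2) (auto simp: jet_def norm_minus_commute)
    qed (use Lp_space_diff[OF L(1) \<phi>L(1)] diffL p in \<open>auto simp: Lp_space_def\<close>)
  qed (auto intro!: always_eventually Bochner_Integration.integral_nonneg)
  moreover have "(\<lambda>n. LINT x|lebesgue_on \<Omega>. norm (wgrad \<Omega> u x - grad (\<phi> n) x) powr p) \<longlonglongrightarrow> 0"
  proof (rule tendsto_sandwich[OF _ _ tendsto_const \<phi>(2)])
    show "\<forall>\<^sub>F n in sequentially. (LINT x|lebesgue_on \<Omega>. norm (wgrad \<Omega> u x - grad (\<phi> n) x) powr p)
        \<le> (LINT x|lebesgue_on \<Omega>. norm (jet (\<phi> n) x - (u x, g x)) powr p)"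
    proof (rule always_eventually, rule allI, rule integral_mono_AE)
      fix n
      show "AE x in lebesgue_on \<Omega>. norm (wgrad \<Omega> u x - grad (\<phi> n) x) powr p \<le> norm (jet (\<phi> n) x - (u x, g x)) powr p"
        using ae
      proof eventually_elim
        case (elim x)
        then show ?case
          using p norm_snd_le[of "grad (\<phi> n) x - g x" "\<phi> n x - u x"]
          by (intro powr_mono2) (auto simp: jet_def norm_minus_commute)
      qed
    qed (use Lp_space_diff[OF gL \<phi>L(2)] diffL p in \<open>auto simp: Lp_space_def\<close>)
  qed (auto intro!: always_eventually Bochner_Integration.integral_nonneg)
  ultimately show "u \<in> W01p p \<Omega>"
    using \<phi>(1) p L gL wg by (auto simp: W01p_def W1p_def Lp_norm_tendsto_0_iff)
qed

lemma W01p_imp_sobolev_pair: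
  fixes u :: "'a::euclidean_space \<Rightarrow> real"
  assumes \<Omega>: "open \<Omega>" "bounded \<Omega>" and p: "p \<ge> 1" and u: "u \<in> W01p p \<Omega>"
  shows "sobolev_pair p \<Omega> (\<lambda>x. (u x, wgrad \<Omega> u x))"
proof -
  have L: "u \<in> Lp_space p \<Omega>" "wgrad \<Omega> u \<in> Lp_space p \<Omega>"
    using u by (auto simp: W01p_def W1p_def)
  then have UL: "(\<lambda>x. (u x, wgrad \<Omega> u x)) \<in> Lp_space p \<Omega>"
    using p by (simp add: Lp_space_Pair_iff)
  obtain \<phi> where \<phi>: "\<And>n. \<phi> n \<in> test_functions \<Omega>"
    and lim: "(\<lambda>n. Lp_norm p \<Omega> (\<lambda>x. u x - \<phi> n x)) \<longlonglongrightarrow> 0"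
      "(\<lambda>n. Lp_norm p \<Omega> (\<lambda>x. wgrad \<Omega> u x - grad (\<phi> n) x)) \<longlonglongrightarrow> 0"
    using u unfolding W01p_def by blast
  have jL: "jet (\<phi> n) \<in> Lp_space p \<Omega>" for n
    using jet_in_Lp_space[OF \<Omega> \<phi>(1)] p by simp
  have \<phi>L: "\<phi> n \<in> Lp_space p \<Omega>" "grad (\<phi> n) \<in> Lp_space p \<Omega>" for n
    using Lp_space_pairD[OF jL[of n]] p by (auto simp: jet_def)
  have p0: "p > 0" using p by simp
  have "sobolev_pair p \<Omega> (jet (\<phi> n))" for n
    by (rule sobolev_pair_jet[OF \<Omega> p0 \<phi>])
  moreover have "(\<lambda>n. LINT x|lebesgue_on \<Omega>. norm (jet (\<phi> n) x - (u x, wgrad \<Omega> u x)) powr p) \<longlonglongrightarrow> 0"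
  proof (rule tendsto_sandwich[OF _ _ tendsto_const])
    let ?b = "\<lambda>n. 2 powr p * ((LINT x|lebesgue_on \<Omega>. norm (u x - \<phi> n x) powr p)
        + (LINT x|lebesgue_on \<Omega>. norm (wgrad \<Omega> u x - grad (\<phi> n) x) powr p))"
    show "?b \<longlonglongrightarrow> 0"
      using lim p by (auto simp: Lp_norm_tendsto_0_iff intro!: tendsto_eq_intros)
    have "(LINT x|lebesgue_on \<Omega>. norm (jet (\<phi> n) x - (u x, wgrad \<Omega> u x)) powr p) \<le> ?b n" for n
    proof -
      have "(LINT x|lebesgue_on \<Omega>. norm (jet (\<phi> n) x - (u x, wgrad \<Omega> u x)) powr p) \<le>
          (LINT x|lebesgue_on \<Omega>. 2 powr p * (norm (u x - \<phi> n x) powr p + norm (wgrad \<Omega> u x - grad (\<phi> n) x) powr p))"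
      proof (rule integral_mono)
        fix x
        have "norm (jet (\<phi> n) x - (u x, wgrad \<Omega> u x)) powr p \<le>
            (norm (u x - \<phi> n x) + norm (wgrad \<Omega> u x - grad (\<phi> n) x)) powr p"
          using p norm_Pair_le[of "\<phi> n x - u x" "grad (\<phi> n) x - wgrad \<Omega> u x"]
          by (intro powr_mono2) (auto simp: jet_def norm_minus_commute)
        also have "\<dots> \<le> 2 powr p * (norm (u x - \<phi> n x) powr p + norm (wgrad \<Omega> u x - grad (\<phi> n) x) powr p)"
          using p by (intro powr_add_le) auto
        finally show "norm (jet (\<phi> n) x - (u x, wgrad \<Omega> u x)) powr p \<le>
            2 powr p * (norm (u x - \<phi> n x) powr p + norm (wgrad \<Omega> u x - grad (\<phi> n) x) powr p)" .
      qed (use Lp_space_diff[OF jL UL] Lp_space_diff[OF L(1) \<phi>L(1)] Lp_space_diff[OF L(2) \<phi>L(2)] p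
            in \<open>auto simp: Lp_space_def\<close>)
      also have "\<dots> = ?b n"
        using Lp_space_diff[OF L(1) \<phi>L(1)] Lp_space_diff[OF L(2) \<phi>L(2)] p by (simp add: Lp_space_def)
      finally show ?thesis .
    qed
    then show "\<forall>\<^sub>F n in sequentially. (LINT x|lebesgue_on \<Omega>. norm (jet (\<phi> n) x - (u x, wgrad \<Omega> u x)) powr p) \<le> ?b n"
      by simp
  qed (auto intro!: always_eventually Bochner_Integration.integral_nonneg)
  ultimately show ?thesis
    by (rule sobolev_pair_limit[OF \<Omega> p0 UL])
qed

section \<open>Positive parts of Sobolev functions\<close>

lemma Ck_ident: "Ck k (\<lambda>t::real. t)"
  using Ck_inner_left[of k "1::real"] by simp

lemma powr_quadratic_has_derivative:
  fixes c d s t :: real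
  assumes "c > 0" "d \<ge> 0"
  shows "((\<lambda>t. (c + d * t\<^sup>2) powr s) has_real_derivative (2 * s * d) * (t * (c + d * t\<^sup>2) powr (s - 1))) (at t)"
proof -
  have "c + d * t\<^sup>2 > 0" using assms by (simp add: add_pos_nonneg)
  then show ?thesis by (auto intro!: derivative_eq_intros)
qed

text \<open>
  The exponent is generalised in the induction because differentiation lowers it by one. The
  exponents \<open>-1\<close> and \<open>1 / 2\<close> give the two regularisations used below.
\<close>
lemma Ck_powr_quadratic:
  fixes c d :: real
  assumes "c > 0" "d \<ge> 0"
  shows "Ck k (\<lambda>t. (c + d * t\<^sup>2) powr s)"
proof (induction k arbitrary: s)
  case 0
  show ?case unfolding Ck.simps
    by (rule DERIV_continuous_on[OF has_field_derivative_at_within[OF powr_quadratic_has_derivative[OF assms]]])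
next
  case (Suc k)
  show ?case
    by (rule Ck_real_SucI[OF powr_quadratic_has_derivative[OF assms]]) (intro Ck_mult Ck_const Ck_ident Suc)
qed

text \<open>
  The functions \<open>h n t = t / (1 + n t\<^sup>2)\<close> tend to \<open>0\<close>, while their derivatives stay bounded and tend to
  the indicator of \<open>{0}\<close>. The chain rule makes the gradient restricted to \<open>{u = 0}\<close> a weak gradient
  of the zero function, and weak gradients are unique.
\<close>
lemma wgrad_zero_on_zero_set:
  fixes u :: "'a::euclidean_space \<Rightarrow> real"
  assumes \<Omega>: "open \<Omega>" "bounded \<Omega>" and p: "p \<ge> 1" and u: "u \<in> W01p p \<Omega>"
  shows "AE x in lebesgue_on \<Omega>. u x = 0 \<longrightarrow> wgrad \<Omega> u x = 0"
proof -
  define D where "D n t = 1 + real n * t\<^sup>2" for n and t :: real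
  define h where "h n t = t / D n t" for n t
  define h' where "h' n t = 2 / (D n t)\<^sup>2 - 1 / D n t" for n t
  have D1: "D n t \<ge> 1" for n t by (simp add: D_def)
  have D0: "D n t \<noteq> 0" "D n t > 0" for n t using D1[of n t] by linarith+
  have D_lim: "(\<lambda>n. 1 / D n t) \<longlonglongrightarrow> (if t = 0 then 1 else 0)" for t
  proof (cases "t = 0")
    case False
    have "filterlim (\<lambda>n. t\<^sup>2 * real n) at_top sequentially"
      using False by (intro filterlim_tendsto_pos_mult_at_top[OF tendsto_const _ filterlim_real_sequentially]) auto
    then have "filterlim (\<lambda>n. D n t) at_top sequentially"
      unfolding D_def by (intro filterlim_tendsto_add_at_top[OF tendsto_const]) (simp add: mult.commute)
    then have "(\<lambda>n. 1 / D n t) \<longlonglongrightarrow> 0"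
      by (intro tendsto_divide_0[OF tendsto_const] filterlim_at_top_imp_at_infinity)
    then show ?thesis using False by simp
  qed (simp add: D_def)
  have h_deriv: "(h n has_real_derivative h' n t) (at t)" for n t
  proof -
    have "((\<lambda>t. t / D n t) has_real_derivative (D n t - t * (real n * (2 * t))) / (D n t * D n t)) (at t)"
      unfolding D_def using D0(1)[of n t, unfolded D_def] by (auto intro!: derivative_eq_intros)
    moreover have "(D n t - t * (real n * (2 * t))) / (D n t * D n t) = h' n t"
    proof -
      have "D n t - t * (real n * (2 * t)) = 2 - D n t" by (simp add: D_def power2_eq_square)
      then show ?thesis using D0(1)[of n t]
        by (simp only: h'_def diff_divide_distrib power2_eq_square) simp
    qed
    ultimately show ?thesis unfolding h_def by simp
  qed
  have h_Ck: "Ck k (h n)" for k n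
  proof -
    have "h n = (\<lambda>t. t * (1 + real n * t\<^sup>2) powr (-1))"
      using D0(2)[of n] by (auto simp: fun_eq_iff h_def D_def powr_minus powr_one divide_inverse less_imp_le)
    then show ?thesis using Ck_mult[OF Ck_ident Ck_powr_quadratic[of 1 "real n" k "-1"]] by simp
  qed
  have h'_bound: "\<bar>h' n t\<bar> \<le> 3" for n t
  proof -
    have "0 \<le> 1 / D n t" "1 / D n t \<le> 1" using D1[of n t] by (auto simp: field_simps)
    moreover have "0 \<le> 2 / (D n t)\<^sup>2" "2 / (D n t)\<^sup>2 \<le> 2"
      using D1[of n t] by (auto simp: divide_le_eq one_le_power)
    ultimately show ?thesis unfolding h'_def by linarith
  qed
  have h'_cont: "continuous_on UNIV (h' n)" for n
    unfolding h'_def[abs_def] D_def using D0(1)[unfolded D_def] by (intro continuous_intros) auto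
  have h_lim: "(\<lambda>n. h n t) \<longlonglongrightarrow> 0" for t
    using tendsto_mult[OF tendsto_const[of t] D_lim[of t]] by (auto simp: h_def split: if_splits)
  have h'_lim: "(\<lambda>n. h' n t) \<longlonglongrightarrow> (if t = 0 then 1 else 0)" for t
  proof -
    have "(\<lambda>n. 2 * (1 / D n t)\<^sup>2 - 1 / D n t) \<longlonglongrightarrow> 2 * (if t = 0 then 1 else 0)\<^sup>2 - (if t = 0 then 1 else 0)"
      by (intro tendsto_intros D_lim)
    then show ?thesis by (auto simp: h'_def power_divide split: if_splits)
  qed
  have "sobolev_pair p \<Omega> (\<lambda>x. (0, (if u x = 0 then 1 else 0) *\<^sub>R wgrad \<Omega> u x))"
    using sobolev_pair_limit_compose[OF \<Omega> _ W01p_imp_sobolev_pair[OF \<Omega> p u] h_Ck h_deriv _ h'_bound h'_cont h_lim h'_lim] p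
    by (simp add: h_def)
  then have "is_weak_gradient \<Omega> (\<lambda>x. 0) (\<lambda>x. (if u x = 0 then 1 else 0) *\<^sub>R wgrad \<Omega> u x)"
    by (rule sobolev_pair_imp_weak_gradient[OF \<Omega> p])
  moreover have "is_weak_gradient \<Omega> (\<lambda>x. 0) (\<lambda>x. 0)"
    by (simp add: is_weak_gradient_def locally_integrable_def)
  ultimately have "AE x in lebesgue_on \<Omega>. (if u x = 0 then 1 else 0) *\<^sub>R wgrad \<Omega> u x = 0"
    by (rule weak_gradient_unique[OF \<Omega>(1)]) simp
  then show ?thesis by eventually_elim (auto split: if_splits)
qed

text \<open>
  For \<open>s = \<plusminus>1\<close> one has \<open>max (s t) 0 = (\<bar>t\<bar> + s t) / 2\<close>, and \<open>\<bar>t\<bar>\<close> is the limit of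
  \<open>sqrt (e + t\<^sup>2) - sqrt e\<close>. The derivatives converge to \<open>(sgn t + s) / 2\<close>, whose value \<open>s / 2\<close> at the
  origin is harmless because the gradient of \<open>u\<close> vanishes on \<open>{u = 0}\<close>. The factor \<open>1 *\<close> in the
  definitions below matches the general form \<open>c + d t\<^sup>2\<close>.
\<close>
lemma pos_part_W01p:
  fixes u :: "'a::euclidean_space \<Rightarrow> real"
  assumes \<Omega>: "open \<Omega>" "bounded \<Omega>" and p: "p \<ge> 1" and u: "u \<in> W01p p \<Omega>" and s: "s = 1 \<or> s = - 1"
  shows "pos_part (\<lambda>x. s * u x) \<in> W01p p \<Omega>"
    and "AE x in lebesgue_on \<Omega>. wgrad \<Omega> (pos_part (\<lambda>x. s * u x)) x = (if s * u x > 0 then s *\<^sub>R wgrad \<Omega> u x else 0)"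
proof -
  define e where "e n = 1 / real (Suc n)" for n
  define h where "h n t = ((e n + 1 * t\<^sup>2) powr (1 / 2) - e n powr (1 / 2) + s * t) / 2" for n t
  define h' where "h' n t = (t * (e n + 1 * t\<^sup>2) powr (1 / 2 - 1) + s) / 2" for n t
  have e: "e n > 0" for n by (simp add: e_def)
  have e_lim: "e \<longlonglongrightarrow> 0" unfolding e_def by (rule LIMSEQ_Suc[OF lim_1_over_n])
  have pos: "e n + 1 * t\<^sup>2 > 0" for n t using e[of n] by (simp add: add_pos_nonneg)
  have root: "(e n + 1 * t\<^sup>2) powr (1 / 2 - 1) = 1 / sqrt (e n + t\<^sup>2)" for n t
    using powr_minus_divide[of "e n + t\<^sup>2" "1 / 2"] pos[of n t] by (simp add: powr_half_sqrt)
  have h_deriv: "(h n has_real_derivative h' n t) (at t)" for n t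
    unfolding h_def h'_def
    by (rule derivative_eq_intros powr_quadratic_has_derivative[OF e] refl | simp)+
  have h_Ck: "Ck k (h n)" for k n
  proof -
    have "Ck k (\<lambda>t. (1 / 2) * ((e n + 1 * t\<^sup>2) powr (1 / 2) - e n powr (1 / 2) + s * t))"
      by (intro Ck_mult Ck_add Ck_diff Ck_const Ck_ident Ck_powr_quadratic e) simp
    then show ?thesis unfolding h_def by simp
  qed
  have h'_bound: "\<bar>h' n t\<bar> \<le> 1" for n t
  proof -
    have "\<bar>t\<bar> \<le> sqrt (e n + t\<^sup>2)" using e[of n] by (intro real_le_rsqrt) auto
    then have "\<bar>t * (1 / sqrt (e n + t\<^sup>2))\<bar> \<le> 1" using pos[of n t] by (simp add: abs_mult)
    moreover have "\<bar>(r + s) / 2\<bar> \<le> 1" if "\<bar>r\<bar> \<le> 1" for r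
      using that s by auto
    ultimately show ?thesis unfolding h'_def root by blast
  qed
  have h'_cont: "continuous_on UNIV (h' n)" for n
    unfolding h'_def using pos[of n]
    by (intro continuous_intros Ck_imp_continuous_on[OF Ck_powr_quadratic[OF e, where k=0]]) auto
  have root_lim: "(\<lambda>n. sqrt (e n + t\<^sup>2)) \<longlonglongrightarrow> \<bar>t\<bar>" for t
    using tendsto_real_sqrt[OF tendsto_add[OF e_lim tendsto_const[of "t\<^sup>2"]]] by simp
  have h_lim: "(\<lambda>n. h n t) \<longlonglongrightarrow> (\<bar>t\<bar> - 0 + s * t) / 2" for t
  proof -
    have "(\<lambda>n. (sqrt (e n + t\<^sup>2) - sqrt (e n) + s * t) / 2) \<longlonglongrightarrow> (\<bar>t\<bar> - sqrt 0 + s * t) / 2"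
      by (intro tendsto_intros root_lim e_lim) simp
    then show ?thesis using e pos by (simp add: h_def powr_half_sqrt less_imp_le)
  qed
  have h'_lim: "(\<lambda>n. h' n t) \<longlonglongrightarrow> (sgn t + s) / 2" for t
  proof (cases "t = 0")
    case False
    have "(\<lambda>n. (t * (1 / sqrt (e n + t\<^sup>2)) + s) / 2) \<longlonglongrightarrow> (t * (1 / \<bar>t\<bar>) + s) / 2"
      using False by (intro tendsto_intros root_lim) auto
    moreover have "t * (1 / \<bar>t\<bar>) = sgn t" using False by (simp add: sgn_real_def)
    ultimately show ?thesis unfolding h'_def root by simp
  qed (simp add: h'_def)
  have h0: "h n 0 = 0" for n by (simp add: h_def)
  have "sobolev_pair p \<Omega> (\<lambda>x. ((\<bar>u x\<bar> - 0 + s * u x) / 2, ((sgn (u x) + s) / 2) *\<^sub>R wgrad \<Omega> u x))"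
    using sobolev_pair_limit_compose[OF \<Omega> _ W01p_imp_sobolev_pair[OF \<Omega> p u] h_Ck h_deriv h0 h'_bound h'_cont h_lim h'_lim] p
    by simp
  moreover have "(\<lambda>x. (\<bar>u x\<bar> - 0 + s * u x) / 2) = pos_part (\<lambda>x. s * u x)"
    using s by (auto simp: fun_eq_iff pos_part_def max_def)
  ultimately have "sobolev_pair p \<Omega> (\<lambda>x. (pos_part (\<lambda>x. s * u x) x, ((sgn (u x) + s) / 2) *\<^sub>R wgrad \<Omega> u x))"
    by metis
  note W = sobolev_pair_imp_W01p[OF \<Omega> p this]
  show "pos_part (\<lambda>x. s * u x) \<in> W01p p \<Omega>" by (rule W(1))
  show "AE x in lebesgue_on \<Omega>. wgrad \<Omega> (pos_part (\<lambda>x. s * u x)) x = (if s * u x > 0 then s *\<^sub>R wgrad \<Omega> u x else 0)"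
    using W(2) wgrad_zero_on_zero_set[OF \<Omega> p u]
  proof eventually_elim
    case (elim x)
    then show ?case using s by (auto simp: sgn_real_def split: if_splits)
  qed
qed

section \<open>The energy identity and the sign of H\<close>

lemma is_weak_gradient_uminus:
  "is_weak_gradient \<Omega> u g \<Longrightarrow> is_weak_gradient \<Omega> (\<lambda>x. - u x) (\<lambda>x. - g x)"
  by (simp add: is_weak_gradient_def locally_integrable_def)

lemma H_uminus:
  assumes "open \<Omega>" "w \<in> W1p p \<Omega>"
  shows "H p \<Omega> \<alpha> (\<lambda>x. - w x) = H p \<Omega> \<alpha> w"
proof -
  have wg: "is_weak_gradient \<Omega> w (wgrad \<Omega> w)"
    using assms(2) unfolding W1p_def wgrad_def by (auto intro: someI[of "is_weak_gradient \<Omega> w"])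
  have ae: "AE x in lebesgue_on \<Omega>. wgrad \<Omega> (\<lambda>x. - w x) x = - wgrad \<Omega> w x"
    by (rule wgrad_AE_eq[OF assms(1) is_weak_gradient_uminus[OF wg]])
  have L: "wgrad \<Omega> w \<in> borel_measurable (lebesgue_on \<Omega>)"
    using assms(2) by (auto simp: W1p_def Lp_space_def)
  have minus: "(\<lambda>x. - wgrad \<Omega> w x) \<in> borel_measurable (lebesgue_on \<Omega>)"
    using L by (rule borel_measurable_uminus)
  have "AE x in lebesgue_on \<Omega>. - wgrad \<Omega> w x = wgrad \<Omega> (\<lambda>x. - w x) x"
    using ae by eventually_elim simp
  from borel_measurable_lebesgue_on_AE[OF open_imp_sets_lebesgue[OF assms(1)] minus this]
  have "Lp_norm p \<Omega> (wgrad \<Omega> (\<lambda>x. - w x)) = Lp_norm p \<Omega> (wgrad \<Omega> w)"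
    unfolding Lp_norm_def using L ae
    by (intro arg_cong[where f="\<lambda>x. x powr (1 / p)"] integral_cong_AE) auto
  moreover have "Lp_norm p \<Omega> (\<lambda>x. - w x) = Lp_norm p \<Omega> w"
    by (simp add: Lp_norm_def)
  ultimately show ?thesis by (simp add: H_def)
qed

lemma powr_diff_2_mult_square:
  fixes a r :: real
  assumes "a \<ge> 0"
  shows "a powr (r - 2) * (a * a) = a powr r"
proof (cases "a = 0")
  case False
  then have "a powr (r - 2) * a powr 2 = a powr r"
    by (simp add: powr_add[symmetric])
  then show ?thesis using False assms by (simp add: powr_numeral power2_eq_square)
qed simp

text \<open>
  The signed part \<open>w\<close> is itself the test function. Where \<open>s u > 0\<close> one has \<open>\<nabla>w = s \<nabla>u\<close> and
  \<open>w = s u = \<bar>u\<bar>\<close>, so all integrands become \<open>s\<close> times powers of \<open>\<bar>\<nabla>w\<bar>\<close> and \<open>\<bar>w\<bar>\<close>; elsewhere both sides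
  vanish. The \<open>q\<close>-th powers are integrable because \<open>\<Omega>\<close> has finite measure and \<open>q < p\<close>.
\<close>
lemma weak_solution_signed_part_energy:
  fixes u :: "'a::euclidean_space \<Rightarrow> real"
  assumes \<Omega>: "open \<Omega>" "bounded \<Omega>" and pq: "1 < q" "q < p"
    and sol: "weak_solution p q \<Omega> \<alpha> \<beta> f u" and s: "s = 1 \<or> s = - 1"
  defines "w \<equiv> pos_part (\<lambda>x. s * u x)"
  shows "H p \<Omega> \<alpha> w + Lp_norm q \<Omega> (wgrad \<Omega> w) powr q - \<beta> * Lp_norm q \<Omega> w powr q = s * f w"
proof -
  note fin = finite_measure_lebesgue_on_bounded_open[OF \<Omega>]
  have u: "u \<in> W01p p \<Omega>" using sol by (simp add: weak_solution_def)
  have p1: "p \<ge> 1" and p0: "p > 0" "q > 0" using pq by auto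
  have w: "w \<in> W01p p \<Omega>" and wg: "AE x in lebesgue_on \<Omega>. wgrad \<Omega> w x = (if s * u x > 0 then s *\<^sub>R wgrad \<Omega> u x else 0)"
    using pos_part_W01p[OF \<Omega> p1 u s] by (simp_all add: w_def)
  have ss: "s * s = 1" "\<bar>s\<bar> = 1" using s by auto
  have um: "u \<in> borel_measurable (lebesgue_on \<Omega>)" "wgrad \<Omega> u \<in> borel_measurable (lebesgue_on \<Omega>)"
    using u by (auto simp: W01p_def W1p_def Lp_space_def)
  have wL: "w \<in> Lp_space p \<Omega>" "wgrad \<Omega> w \<in> Lp_space p \<Omega>"
    using w by (auto simp: W01p_def W1p_def)
  then have wLq: "w \<in> Lp_space q \<Omega>" "wgrad \<Omega> w \<in> Lp_space q \<Omega>"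
    using Lp_space_mono[OF fin, of _ p q] pq by auto
  have wm: "w \<in> borel_measurable (lebesgue_on \<Omega>)" "wgrad \<Omega> w \<in> borel_measurable (lebesgue_on \<Omega>)"
    using wL by (auto simp: Lp_space_def)
  have "(LINT x|lebesgue_on \<Omega>. (norm (wgrad \<Omega> u x) powr (p - 2) + norm (wgrad \<Omega> u x) powr (q - 2)) *
        (wgrad \<Omega> u x \<bullet> wgrad \<Omega> w x))
      = (LINT x|lebesgue_on \<Omega>. s * (norm (wgrad \<Omega> w x) powr p + norm (wgrad \<Omega> w x) powr q))"
  proof (rule integral_cong_AE)
    show "AE x in lebesgue_on \<Omega>. (norm (wgrad \<Omega> u x) powr (p - 2) + norm (wgrad \<Omega> u x) powr (q - 2)) *
        (wgrad \<Omega> u x \<bullet> wgrad \<Omega> w x) = s * (norm (wgrad \<Omega> w x) powr p + norm (wgrad \<Omega> w x) powr q)"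
      using wg
    proof eventually_elim
      case (elim x)
      show ?case
      proof (cases "s * u x > 0")
        case True
        let ?g = "norm (wgrad \<Omega> u x)"
        have "(?g powr (p - 2) + ?g powr (q - 2)) * (s * (?g * ?g)) = s * (?g powr p + ?g powr q)"
          using powr_diff_2_mult_square[of ?g p] powr_diff_2_mult_square[of ?g q]
          by (simp add: algebra_simps)
        then show ?thesis
          using True elim by (simp add: ss power2_norm_eq_inner[symmetric] power2_eq_square)
      qed (use elim in simp)
    qed
  qed (use um wm in measurable)
  also have "\<dots> = s * (Lp_norm p \<Omega> (wgrad \<Omega> w) powr p + Lp_norm q \<Omega> (wgrad \<Omega> w) powr q)"
    using wL wLq p0 by (simp add: Lp_norm_powr Lp_space_def)
  finally have lhs: "(LINT x|lebesgue_on \<Omega>. (norm (wgrad \<Omega> u x) powr (p - 2) + norm (wgrad \<Omega> u x) powr (q - 2)) *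
        (wgrad \<Omega> u x \<bullet> wgrad \<Omega> w x)) = s * (Lp_norm p \<Omega> (wgrad \<Omega> w) powr p + Lp_norm q \<Omega> (wgrad \<Omega> w) powr q)" .
  have "(LINT x|lebesgue_on \<Omega>. (\<alpha> * \<bar>u x\<bar> powr (p - 2) * u x + \<beta> * \<bar>u x\<bar> powr (q - 2) * u x) * w x)
      = (LINT x|lebesgue_on \<Omega>. s * (\<alpha> * norm (w x) powr p + \<beta> * norm (w x) powr q))"
  proof (rule Bochner_Integration.integral_cong)
    fix x
    show "(\<alpha> * \<bar>u x\<bar> powr (p - 2) * u x + \<beta> * \<bar>u x\<bar> powr (q - 2) * u x) * w x
        = s * (\<alpha> * norm (w x) powr p + \<beta> * norm (w x) powr q)"
    proof (cases "s * u x > 0")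
      case True
      let ?v = "\<bar>u x\<bar>"
      have w: "w x = s * u x" and v: "s * u x = ?v"
        using True s by (auto simp: w_def pos_part_def)
      have uw: "u x * w x = s * (?v * ?v)" by (simp add: w)
      have "(\<alpha> * ?v powr (p - 2) * u x + \<beta> * ?v powr (q - 2) * u x) * w x
          = (\<alpha> * ?v powr (p - 2) + \<beta> * ?v powr (q - 2)) * (u x * w x)"
        by (simp add: algebra_simps)
      also have "\<dots> = s * (\<alpha> * (?v powr (p - 2) * (?v * ?v)) + \<beta> * (?v powr (q - 2) * (?v * ?v)))"
        unfolding uw by (simp add: algebra_simps)
      finally have "(\<alpha> * ?v powr (p - 2) * u x + \<beta> * ?v powr (q - 2) * u x) * w x
          = s * (\<alpha> * (?v powr (p - 2) * (?v * ?v)) + \<beta> * (?v powr (q - 2) * (?v * ?v)))" .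
      then show ?thesis
        using powr_diff_2_mult_square[of ?v p] powr_diff_2_mult_square[of ?v q] by (simp add: w v)
    qed (simp add: w_def pos_part_def)
  qed simp
  also have "\<dots> = s * (\<alpha> * Lp_norm p \<Omega> w powr p + \<beta> * Lp_norm q \<Omega> w powr q)"
    using wL wLq p0 by (simp add: Lp_norm_powr Lp_space_def)
  finally have "s * (Lp_norm p \<Omega> (wgrad \<Omega> w) powr p + Lp_norm q \<Omega> (wgrad \<Omega> w) powr q)
      = s * (\<alpha> * Lp_norm p \<Omega> w powr p + \<beta> * Lp_norm q \<Omega> w powr q) + f w"
    using sol w lhs by (simp add: weak_solution_def)
  \<comment> \<open>Multiplication by \<open>s\<close> removes the sign on the left, as \<open>s\<^sup>2 = 1\<close>.\<close>
  then have "s * (s * (Lp_norm p \<Omega> (wgrad \<Omega> w) powr p + Lp_norm q \<Omega> (wgrad \<Omega> w) powr q))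
      = s * (s * (\<alpha> * Lp_norm p \<Omega> w powr p + \<beta> * Lp_norm q \<Omega> w powr q) + f w)"
    by simp
  then show ?thesis using s by (auto simp: H_def algebra_simps)
qed

text \<open>
  With the weights \<open>a = (q - 1) / (p - 1)\<close> and \<open>b = (p - q) / (p - 1)\<close>, which add up to \<open>1\<close>, the constant
  equals \<open>a powr (- a) * b powr (- b)\<close>. The claim is the weighted inequality between arithmetic and
  geometric means for \<open>x / a\<close> and \<open>y / b\<close>.
\<close>
lemma Young_Phi_constant:
  fixes p q x y :: real
  assumes "1 < q" "q < p" "x \<ge> 0" "y \<ge> 0"
  shows "(p - 1) / (p - q) * ((p - q) / (q - 1)) powr ((q - 1) / (p - 1)) *
      (x powr ((q - 1) / (p - 1)) * y powr ((p - q) / (p - 1))) \<le> x + y"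
proof (cases "x = 0 \<or> y = 0")
  case True
  then show ?thesis using assms by auto
next
  case False
  define a where "a = (q - 1) / (p - 1)"
  define b where "b = (p - q) / (p - 1)"
  have ab: "a > 0" "b > 0" "a + b = 1" using assms by (auto simp: a_def b_def add_divide_distrib[symmetric])
  have pos: "x > 0" "y > 0" using False assms by auto
  have "b / a = (p - q) / (q - 1)" "1 / b = (p - 1) / (p - q)"
    using assms by (auto simp: a_def b_def)
  then have "(p - 1) / (p - q) * ((p - q) / (q - 1)) powr a * (x powr a * y powr b)
      = 1 / b * (b / a) powr a * (x powr a * y powr b)" by simp
  also have "\<dots> = (x / a) powr a * (y / b) powr b"
  proof -
    have "b powr a * b powr b = b" using ab by (simp add: powr_add[symmetric])
    then have "1 / b * b powr a = 1 / b powr b" using ab by (simp add: field_simps)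
    then show ?thesis using ab pos by (simp add: powr_divide)
  qed
  also have "\<dots> \<le> a * (x / a) + b * (y / b)"
    using ab pos by (intro Youngs_inequality_0) auto
  also have "\<dots> = x + y" using ab by simp
  finally show ?thesis by (simp add: a_def b_def)
qed

lemma Lp_norm_powr_pos:
  assumes "w \<in> Lp_space q \<Omega>" "q > 0" "\<not> ae_zero \<Omega> w"
  shows "Lp_norm q \<Omega> w powr q > 0"
proof (rule ccontr)
  assume "\<not> Lp_norm q \<Omega> w powr q > 0"
  then have "Lp_norm q \<Omega> w powr q = 0" using powr_ge_zero[of "Lp_norm q \<Omega> w" q] by linarith
  then have "(LINT x|lebesgue_on \<Omega>. norm (w x) powr q) = 0"
    using assms(2) by (simp add: Lp_norm_powr)
  then have "AE x in lebesgue_on \<Omega>. norm (w x) powr q = 0"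
    using assms(1) by (subst (asm) integral_nonneg_eq_0_iff_AE) (auto simp: Lp_space_def)
  then show False using assms(3) by (simp add: ae_zero_def)
qed

text \<open>
  The factor \<open>s\<close> treats the upper bound for \<open>\<Phi>\<^sup>+\<close> and the lower bound for \<open>\<Phi>\<^sup>-\<close> together: it turns the
  last term of \<open>\<Phi>\<close> into a nonnegative quantity, to which Young's inequality applies.
\<close>
lemma Phi_mult_Lp_norm:
  assumes "1 < q" "q < p" "s = 1 \<or> s = - 1" "s * H p \<Omega> \<alpha> w \<ge> 0" "f w \<ge> 0"
    "Lp_norm q \<Omega> w powr q > 0"
  shows "s * (Phi s p q \<Omega> f \<alpha> w * Lp_norm q \<Omega> w powr q) \<le>
    s * Lp_norm q \<Omega> (wgrad \<Omega> w) powr q + s * H p \<Omega> \<alpha> w + f w"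
proof -
  define N where "N = Lp_norm q \<Omega> w powr q"
  define Y where "Y = (p - 1) / (p - q) * ((p - q) / (q - 1)) powr ((q - 1) / (p - 1)) *
      ((s * H p \<Omega> \<alpha> w) powr ((q - 1) / (p - 1)) * f w powr ((p - q) / (p - 1)))"
  have "Phi s p q \<Omega> f \<alpha> w = Lp_norm q \<Omega> (wgrad \<Omega> w) powr q / N + s * (Y / N)"
    by (simp add: Phi_def Y_def N_def)
  then have "Phi s p q \<Omega> f \<alpha> w * N = Lp_norm q \<Omega> (wgrad \<Omega> w) powr q + s * Y"
    using assms(6) by (simp add: N_def[symmetric] field_simps)
  then have "s * (Phi s p q \<Omega> f \<alpha> w * N) = s * Lp_norm q \<Omega> (wgrad \<Omega> w) powr q + Y"
    using assms(3) by auto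
  moreover have "Y \<le> s * H p \<Omega> \<alpha> w + f w"
    unfolding Y_def by (rule Young_Phi_constant) (use assms in auto)
  ultimately show ?thesis by (simp add: N_def)
qed

theorem proposition2p10:
  fixes \<Omega> :: "'a::euclidean_space set" and p q \<alpha> \<beta> :: real
    and f :: "('a \<Rightarrow> real) \<Rightarrow> real" and u :: "'a \<Rightarrow> real"
  assumes "open \<Omega>" and "connected \<Omega>" and "\<Omega> \<noteq> {}" and "bounded \<Omega>" and "C2_boundary \<Omega>"
    and "1 < q" and "q < p"
    and "f \<in> W01p_dual p \<Omega>" and "\<exists>w\<in>W01p p \<Omega>. f w \<noteq> 0" and "weakly_nonneg p \<Omega> f"
    and "ereal \<alpha> > lambda1 p \<Omega>"
    and "weak_solution p q \<Omega> \<alpha> \<beta> f u"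
  shows "(ereal \<beta> < beta_lower p q \<Omega> f \<alpha> \<and> \<not> ae_zero \<Omega> (neg_part u) \<longrightarrow>
            H p \<Omega> \<alpha> (neg_part u) < 0) \<and>
         (ereal \<beta> > beta_upper p q \<Omega> f \<alpha> \<and> \<not> ae_zero \<Omega> (pos_part u) \<longrightarrow>
            H p \<Omega> \<alpha> (pos_part u) > 0)"
proof -
  note fin = finite_measure_lebesgue_on_bounded_open[OF assms(1,4)]
  have u: "u \<in> W01p p \<Omega>" using assms(12) by (simp add: weak_solution_def)
  have p1: "p \<ge> 1" using assms(6,7) by simp
  \<comment> \<open>The explicit factors \<open>-1\<close> and \<open>1\<close> match the form \<open>s * u x\<close> of the preceding lemmas.\<close>
  define v where "v = pos_part (\<lambda>x. - 1 * u x)"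
  define w where "w = pos_part (\<lambda>x. 1 * u x)"
  have mem: "v \<in> W01p p \<Omega>" "w \<in> W01p p \<Omega>"
    unfolding v_def w_def by (rule pos_part_W01p(1)[OF assms(1,4) p1 u]; simp)+
  have Lq: "x \<in> Lp_space q \<Omega>" if "x \<in> W01p p \<Omega>" for x
    using that assms(6,7) by (auto simp: W01p_def W1p_def intro: Lp_space_mono[OF fin])
  have nonneg: "ae_nonneg \<Omega> v" "ae_nonneg \<Omega> w"
    by (auto simp: ae_nonneg_def v_def w_def pos_part_def)
  then have f_nonneg: "f v \<ge> 0" "f w \<ge> 0"
    using assms(10) mem by (auto simp: weakly_nonneg_def)
  have neg: "neg_part u = (\<lambda>x. - v x)"
    by (auto simp: fun_eq_iff neg_part_def v_def pos_part_def min_def max_def)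
  have w_eq: "w = pos_part u" by (simp add: w_def)
  have H_neg: "H p \<Omega> \<alpha> (neg_part u) = H p \<Omega> \<alpha> v"
    unfolding neg using assms(1) mem(1) by (intro H_uminus) (auto simp: W01p_def)
  have energy_v: "H p \<Omega> \<alpha> v + Lp_norm q \<Omega> (wgrad \<Omega> v) powr q - \<beta> * Lp_norm q \<Omega> v powr q = - f v"
    using weak_solution_signed_part_energy[OF assms(1,4,6,7,12), of "- 1"] by (simp add: v_def)
  have energy_w: "H p \<Omega> \<alpha> w + Lp_norm q \<Omega> (wgrad \<Omega> w) powr q - \<beta> * Lp_norm q \<Omega> w powr q = f w"
    using weak_solution_signed_part_energy[OF assms(1,4,6,7,12), of 1] by (simp add: w_def)
  have "H p \<Omega> \<alpha> v < 0" if \<beta>: "ereal \<beta> < beta_lower p q \<Omega> f \<alpha>" and nz: "\<not> ae_zero \<Omega> (neg_part u)"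
  proof (rule ccontr)
    assume "\<not> H p \<Omega> \<alpha> v < 0"
    then have H: "H p \<Omega> \<alpha> v \<ge> 0" by simp
    have nz': "\<not> ae_zero \<Omega> v" using nz by (simp add: neg ae_zero_def)
    then have N: "Lp_norm q \<Omega> v powr q > 0"
      using Lq[OF mem(1)] assms(6) by (intro Lp_norm_powr_pos) auto
    have "v \<in> B 1 p \<Omega> \<alpha>" using mem nz' nonneg H by (simp add: B_def)
    then have "beta_lower p q \<Omega> f \<alpha> \<le> ereal (Phi 1 p q \<Omega> f \<alpha> v)"
      unfolding beta_lower_def by (rule INF_lower)
    then have "\<beta> < Phi 1 p q \<Omega> f \<alpha> v" using \<beta> order_less_le_trans by fastforce
    then have "\<beta> * Lp_norm q \<Omega> v powr q < Phi 1 p q \<Omega> f \<alpha> v * Lp_norm q \<Omega> v powr q"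
      using N by (intro mult_strict_right_mono)
    then show False
      using Phi_mult_Lp_norm[of q p 1 \<Omega> \<alpha> v f] energy_v assms(6,7) H f_nonneg N by simp
  qed
  moreover have "H p \<Omega> \<alpha> w > 0" if \<beta>: "ereal \<beta> > beta_upper p q \<Omega> f \<alpha>" and nz: "\<not> ae_zero \<Omega> (pos_part u)"
  proof (rule ccontr)
    assume "\<not> H p \<Omega> \<alpha> w > 0"
    then have H: "H p \<Omega> \<alpha> w \<le> 0" by simp
    have nz': "\<not> ae_zero \<Omega> w" using nz by (simp add: w_eq)
    then have N: "Lp_norm q \<Omega> w powr q > 0"
      using Lq[OF mem(2)] assms(6) by (intro Lp_norm_powr_pos) auto
    have "w \<in> B (- 1) p \<Omega> \<alpha>" using mem nz' nonneg H by (simp add: B_def)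
    then have "ereal (Phi (- 1) p q \<Omega> f \<alpha> w) \<le> beta_upper p q \<Omega> f \<alpha>"
      unfolding beta_upper_def by (rule SUP_upper)
    then have "Phi (- 1) p q \<Omega> f \<alpha> w < \<beta>" using \<beta> order_le_less_trans by fastforce
    then have "Phi (- 1) p q \<Omega> f \<alpha> w * Lp_norm q \<Omega> w powr q < \<beta> * Lp_norm q \<Omega> w powr q"
      using N by (intro mult_strict_right_mono)
    then show False
      using Phi_mult_Lp_norm[of q p "- 1" \<Omega> \<alpha> w f] energy_w assms(6,7) H f_nonneg N by simp
  qed
  ultimately show ?thesis by (simp add: H_neg w_eq)
qed

end
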